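(* Let $T,S\in\mathcal{L}(H)$ have the polar decompositions $T=U|T|$ and $S=V|S|$, respectively. Then $TS$ has the polar decomposition if and only if $|T|\,|S^*|$ has the polar decomposition.
   Context: $\mathfrak{A}$ is a $C^*$-algebra, $H$ is a (right) Hilbert $\mathfrak{A}$-module, and $\mathcal{L}(H)$ is the $C^*$-algebra of adjointable operators on $H$. For $T\in\mathcal{L}(H)$, $|T|=(T^*T)^{1/2}$, $|T^*|=(TT^* )^{1/2}$, and $\mathcal{R}(T)$ is the range of $T$. A closed submodule $M\subseteq H$ is orthogonally complemented if $H=M\dotplus M^\perp$; then $P_M$ denotes the projection from $H$ onto $M$. An element $W\in\mathcal{L}(H)$ is a partial isometry if $W^*W$ is a projection. "$T=U|T|$ is the polar decomposition of $T$" means: $U\in\mathcal{L}(H)$ is a partial isometry, $T=U|T|$, $\overline{\mathcal{R}(T^* )}$ is orthogonally complemented, and $U^*U=P_{\overline{\mathcal{R}(T^* )}}$; $T$ "has the polar decomposition" if such a $U$ exists. (Such a $U$ is unique when it exists, and it exists if and only if both $\overline{\mathcal{R}(T^* )}$ and $\overline{\mathcal{R}(T)}$ are orthogonally complemented.) *)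

theory Defs
  imports "HOL-Analysis.Analysis"
begin

class scaleC = fixes scaleC :: "complex \<Rightarrow> 'a \<Rightarrow> 'a"  (infixr \<open>*\<^sub>C\<close> 75)

class complex_vector = scaleC + real_vector +
  assumes scaleC_add_right: "a *\<^sub>C (x + y) = a *\<^sub>C x + a *\<^sub>C y"
    and scaleC_add_left: "(a + b) *\<^sub>C x = a *\<^sub>C x + b *\<^sub>C x"
    and scaleC_scaleC: "a *\<^sub>C (b *\<^sub>C x) = (a * b) *\<^sub>C x"
    and scaleC_one: "1 *\<^sub>C x = x"
    and scaleR_scaleC: "r *\<^sub>R x = complex_of_real r *\<^sub>C x"

class complex_normed_vector = complex_vector + real_normed_vector +
  assumes norm_scaleC: "norm (a *\<^sub>C x) = cmod a * norm x"

class complex_banach = complex_normed_vector + complete_space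

text \<open>C*-algebras are not assumed to be unital.\<close>

class cstar_algebra = complex_banach + real_normed_algebra +
  fixes star :: "'a \<Rightarrow> 'a"  (\<open>_\<^sup>\<star>\<close> [1000] 1000)
  assumes mult_scaleC_left: "(c *\<^sub>C a) * b = c *\<^sub>C (a * b)"
    and mult_scaleC_right: "a * (c *\<^sub>C b) = c *\<^sub>C (a * b)"
    and star_add: "(a + b)\<^sup>\<star> = a\<^sup>\<star> + b\<^sup>\<star>"
    and star_scaleC: "(c *\<^sub>C a)\<^sup>\<star> = cnj c *\<^sub>C a\<^sup>\<star>"
    and star_mult: "(a * b)\<^sup>\<star> = b\<^sup>\<star> * a\<^sup>\<star>"
    and star_star: "a\<^sup>\<star>\<^sup>\<star> = a"
    and cstar_identity: "norm (a\<^sup>\<star> * a) = (norm a)\<^sup>2"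

text \<open>The spectrum is taken in the unitization, so it always contains 0. For
  \<open>\<lambda> \<noteq> 0\<close>, \<open>\<lambda> - a\<close> is invertible there iff \<open>1 - c\<close> is, where \<open>c = \<lambda>\<^sup>-\<^sup>1 a\<close>; an inverse
  of \<open>1 - c\<close> necessarily has the form \<open>1 - b\<close> with \<open>b\<close> in the algebra, and
  \<open>(1 - c)(1 - b) = 1 = (1 - b)(1 - c)\<close> says \<open>c + b = c b = b c\<close>.\<close>

definition quasi_invertible :: "'a::cstar_algebra \<Rightarrow> bool" where
  "quasi_invertible c \<longleftrightarrow> (\<exists>b. c + b = c * b \<and> c + b = b * c)"

definition spectrum :: "'a::cstar_algebra \<Rightarrow> complex set" where
  "spectrum a = {l. l = 0 \<or> \<not> quasi_invertible (inverse l *\<^sub>C a)}"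

definition positive :: "'a::cstar_algebra \<Rightarrow> bool" where
  "positive a \<longleftrightarrow> a\<^sup>\<star> = a \<and> spectrum a \<subseteq> \<real>\<^sub>\<ge>\<^sub>0"

text \<open>Right Hilbert modules; the inner product is conjugate linear in the first and
  linear in the second argument. Completeness comes from the class, whose norm
  is required to be the one induced by the inner product.\<close>

locale hilbert_module =
  fixes ip :: "'h::complex_banach \<Rightarrow> 'h \<Rightarrow> 'a::cstar_algebra"  (\<open>\<langle>_, _\<rangle>\<close>)
    and act :: "'h \<Rightarrow> 'a \<Rightarrow> 'h"  (infixl \<open>\<cdot>\<close> 76)
  assumes act_add_left: "(x + y) \<cdot> a = x \<cdot> a + y \<cdot> a"
    and act_add_right: "x \<cdot> (a + b) = x \<cdot> a + x \<cdot> b"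
    and act_mult: "x \<cdot> (a * b) = (x \<cdot> a) \<cdot> b"
    and act_scaleC_left: "(c *\<^sub>C x) \<cdot> a = c *\<^sub>C (x \<cdot> a)"
    and act_scaleC_right: "x \<cdot> (c *\<^sub>C a) = c *\<^sub>C (x \<cdot> a)"
    and ip_add_right: "\<langle>x, y + z\<rangle> = \<langle>x, y\<rangle> + \<langle>x, z\<rangle>"
    and ip_scaleC_right: "\<langle>x, c *\<^sub>C y\<rangle> = c *\<^sub>C \<langle>x, y\<rangle>"
    and ip_act_right: "\<langle>x, y \<cdot> a\<rangle> = \<langle>x, y\<rangle> * a"
    and ip_star: "\<langle>x, y\<rangle>\<^sup>\<star> = \<langle>y, x\<rangle>"
    and ip_positive: "positive \<langle>x, x\<rangle>"
    and ip_definite: "\<langle>x, x\<rangle> = 0 \<Longrightarrow> x = 0"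
    and norm_ip: "norm x = sqrt (norm \<langle>x, x\<rangle>)"
begin

definition is_adjoint :: "('h \<Rightarrow> 'h) \<Rightarrow> ('h \<Rightarrow> 'h) \<Rightarrow> bool" where
  "is_adjoint T T' \<longleftrightarrow> (\<forall>x y. \<langle>T x, y\<rangle> = \<langle>x, T' y\<rangle>)"

text \<open>Existence of an adjoint forces an operator to be \<open>\<AA>\<close>-linear and bounded.\<close>

definition adjointable :: "('h \<Rightarrow> 'h) set"  (\<open>\<L>\<close>) where
  "\<L> = {T. \<exists>T'. is_adjoint T T'}"

definition adj :: "('h \<Rightarrow> 'h) \<Rightarrow> 'h \<Rightarrow> 'h"  (\<open>_\<^sup>\<dagger>\<close> [1000] 1000) where
  "T\<^sup>\<dagger> = (THE T'. is_adjoint T T')"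

definition op_spectrum :: "('h \<Rightarrow> 'h) \<Rightarrow> complex set" where
  "op_spectrum T = {l. \<not> (\<exists>R\<in>\<L>. R \<circ> (\<lambda>x. T x - l *\<^sub>C x) = id \<and> (\<lambda>x. T x - l *\<^sub>C x) \<circ> R = id)}"

definition positive_op :: "('h \<Rightarrow> 'h) \<Rightarrow> bool" where
  "positive_op T \<longleftrightarrow> T \<in> \<L> \<and> T\<^sup>\<dagger> = T \<and> op_spectrum T \<subseteq> \<real>\<^sub>\<ge>\<^sub>0"

definition op_sqrt :: "('h \<Rightarrow> 'h) \<Rightarrow> 'h \<Rightarrow> 'h" where
  "op_sqrt A = (THE R. positive_op R \<and> R \<circ> R = A)"

definition op_abs :: "('h \<Rightarrow> 'h) \<Rightarrow> 'h \<Rightarrow> 'h" where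
  "op_abs T = op_sqrt (T\<^sup>\<dagger> \<circ> T)"

definition submodule :: "'h set \<Rightarrow> bool" where
  "submodule M \<longleftrightarrow> 0 \<in> M \<and> (\<forall>x\<in>M. \<forall>y\<in>M. x + y \<in> M)
     \<and> (\<forall>x\<in>M. \<forall>c. c *\<^sub>C x \<in> M) \<and> (\<forall>x\<in>M. \<forall>a. x \<cdot> a \<in> M)"

definition orth_compl :: "'h set \<Rightarrow> 'h set"  (\<open>_\<^sup>\<bottom>\<close> [1000] 1000) where
  "M\<^sup>\<bottom> = {x. \<forall>y\<in>M. \<langle>x, y\<rangle> = 0}"

definition orthogonally_complemented :: "'h set \<Rightarrow> bool" where
  "orthogonally_complemented M \<longleftrightarrow> closed M \<and> submodule M
     \<and> {m + n | m n. m \<in> M \<and> n \<in> M\<^sup>\<bottom>} = UNIV \<and> M \<inter> M\<^sup>\<bottom> = {0}"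

definition proj_onto :: "'h set \<Rightarrow> 'h \<Rightarrow> 'h" where
  "proj_onto M x = (THE m. m \<in> M \<and> x - m \<in> M\<^sup>\<bottom>)"

definition projection :: "('h \<Rightarrow> 'h) \<Rightarrow> bool" where
  "projection P \<longleftrightarrow> P \<in> \<L> \<and> P\<^sup>\<dagger> = P \<and> P \<circ> P = P"

definition partial_isometry :: "('h \<Rightarrow> 'h) \<Rightarrow> bool" where
  "partial_isometry W \<longleftrightarrow> W \<in> \<L> \<and> projection (W\<^sup>\<dagger> \<circ> W)"

definition polar_decomposition :: "('h \<Rightarrow> 'h) \<Rightarrow> ('h \<Rightarrow> 'h) \<Rightarrow> bool" where
  "polar_decomposition T U \<longleftrightarrow> partial_isometry U \<and> T = U \<circ> op_abs T
     \<and> orthogonally_complemented (closure (range (T\<^sup>\<dagger>)))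
     \<and> U\<^sup>\<dagger> \<circ> U = proj_onto (closure (range (T\<^sup>\<dagger>)))"

definition has_polar_decomposition :: "('h \<Rightarrow> 'h) \<Rightarrow> bool" where
  "has_polar_decomposition T \<longleftrightarrow> (\<exists>U. polar_decomposition T U)"

end

end

theory Submission
  imports Defs
begin

text \<open>
  Write \<open>A = |T| |S\<^sup>*|\<close>. From \<open>T = U |T|\<close> and \<open>S = |S\<^sup>*| V\<close> follow \<open>T S = U A V\<close> and, as \<open>U\<^sup>* U\<close> and \<open>V V\<^sup>*\<close> act
  as identities next to \<open>A\<close>, also \<open>A = U\<^sup>* (T S) V\<^sup>*\<close>. So \<open>A\<close> and \<open>T S\<close> arise from each other by multiplying
  with partial isometries whose projections do not cut anything off. Such a multiplication
  transports polar decompositions: if \<open>A = W |A|\<close>, then \<open>U A V\<close> has the modulus \<open>V\<^sup>* |A| V\<close> and the partial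
  isometry \<open>U W V\<close> (\<open>polar_decomposition_sandwich\<close>). Both implications are instances of this.

  The computation identifies moduli through the uniqueness of positive square roots, and it
  needs their existence to know anything about \<open>|T|\<close> at all. Positivity is defined here by the
  spectrum, both in the algebra and for operators. Most of the text therefore develops a small
  elementary theory of positivity, without holomorphic functional calculus or representations.

  Its basis is that \<open>m - X\<close> has a selfadjoint square root when \<open>X\<close> is selfadjoint of norm less than
  \<open>m\<close>, by Banach's fixed point theorem (\<open>sqrt_shift\<close>), and that a sum of squares of commuting
  selfadjoint operators dominates each summand in norm (\<open>norm_le_commuting_sum\<close>). These two
  facts replace the spectral radius formula: a selfadjoint \<open>R\<close> without negative spectrum satisfies
  \<open>\<parallel>t - R\<parallel> \<le> t\<close> for \<open>t \<ge> \<parallel>R\<parallel>\<close> (\<open>shift_contraction\<close>). Applied to the left multiplications of the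
  algebra, they show that the norm is monotone on positive elements (\<open>norm_le_add_positive\<close>).
  Applied to operators on the module, whose inner product has positive values, they show that
  positivity of the spectrum is positivity of the quadratic form. In terms of the form, \<open>T\<^sup>* T\<close> is
  visibly positive, square roots are limits of square roots of \<open>A + e\<close> (\<open>positive_sqrt_exists\<close>), and
  two positive roots of the same operator coincide (\<open>positive_sqrt_unique\<close>).
\<close>

instance complex_banach \<subseteq> banach by standard

section \<open>Scalars and the involution\<close>

lemma scaleC_zero_right [simp]: "c *\<^sub>C (0::'a::complex_vector) = 0"
  using scaleC_add_right[of c "0::'a" 0] by simp

lemma scaleC_minus_right: "c *\<^sub>C (- x::'a::complex_vector) = - (c *\<^sub>C x)"
  using scaleC_add_right[of c x "- x"] by (simp add: eq_neg_iff_add_eq_0 add.commute)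

lemma scaleC_diff_right: "c *\<^sub>C (x - y::'a::complex_vector) = c *\<^sub>C x - c *\<^sub>C y"
  using scaleC_add_right[of c x "- y"] by (simp add: scaleC_minus_right)

lemma scaleC_of_real: "complex_of_real r *\<^sub>C (x::'a::complex_vector) = r *\<^sub>R x"
  by (simp add: scaleR_scaleC)

lemma scaleC_minus_left: "(- c) *\<^sub>C (x::'a::complex_vector) = - (c *\<^sub>C x)"
proof -
  have "(- c) *\<^sub>C x = (c * complex_of_real (- 1)) *\<^sub>C x" by simp
  also have "\<dots> = c *\<^sub>C ((- 1) *\<^sub>R x)"
    by (simp only: scaleC_scaleC[symmetric] scaleC_of_real)
  finally show ?thesis by (simp add: scaleC_minus_right)
qed

lemma star_zero [simp]: "(0::'a::cstar_algebra)\<^sup>\<star> = 0"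
  using star_add[of "0::'a" 0] by simp

lemma star_minus: "(- a::'a::cstar_algebra)\<^sup>\<star> = - a\<^sup>\<star>"
  using star_add[of a "- a"] by (simp add: eq_neg_iff_add_eq_0 add.commute)

lemma star_diff: "(a - b::'a::cstar_algebra)\<^sup>\<star> = a\<^sup>\<star> - b\<^sup>\<star>"
  using star_add[of a "- b"] by (simp add: star_minus)

lemma star_scaleR: "(r *\<^sub>R (a::'a::cstar_algebra))\<^sup>\<star> = r *\<^sub>R a\<^sup>\<star>"
  by (simp add: scaleR_scaleC star_scaleC)

lemma norm_star: "norm (a\<^sup>\<star>) = norm (a::'a::cstar_algebra)"
proof -
  have le: "norm b \<le> norm (b\<^sup>\<star>)" for b :: 'a
  proof (cases "b = 0")
    case False
    have "norm b * norm b \<le> norm (b\<^sup>\<star>) * norm b"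
      using cstar_identity[of b] norm_mult_ineq[of "b\<^sup>\<star>" b] by (simp add: power2_eq_square)
    thus ?thesis using False by simp
  qed simp
  show ?thesis using le[of a] le[of "a\<^sup>\<star>"] by (simp add: star_star)
qed

section \<open>Hermitian forms with values in a C*-algebra\<close>

text \<open>The common features of the inner product of a Hilbert module and of the form \<open>a\<^sup>\<star> b\<close> on the
  algebra itself, for which the condition on the norm is the C*-identity. That the elements
  \<open>a\<^sup>\<star> a\<close> have nonnegative spectrum is a nontrivial theorem, so positivity of the form cannot be
  presupposed. Square roots
  are constructed in this generality, then used on the algebra to learn how positive elements
  behave, and used again on the module.\<close>

locale hermitian_form =
  fixes ip :: "'h::complex_banach \<Rightarrow> 'h \<Rightarrow> 'a::cstar_algebra"
  assumes ip_add: "ip x (y + z) = ip x y + ip x z"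
    and ip_scaleC: "ip x (c *\<^sub>C y) = c *\<^sub>C ip x y"
    and ip_hermitian: "(ip x y)\<^sup>\<star> = ip y x"
    and norm_form: "norm (ip x x) = (norm x)\<^sup>2"
begin

lemma ip_scaleR: "ip x (r *\<^sub>R y) = r *\<^sub>R ip x y"
  by (simp add: scaleR_scaleC ip_scaleC)

lemma ip_zero [simp]: "ip x 0 = 0"
  using ip_scaleR[of x 0 0] by simp

lemma ip_minus: "ip x (- y) = - ip x y"
  using ip_scaleR[of x "- 1" y] by simp

lemma ip_diff: "ip x (y - z) = ip x y - ip x z"
  using ip_add[of x y "- z"] by (simp add: ip_minus)

lemma ip_add': "ip (x + y) z = ip x z + ip y z"
  by (metis ip_add ip_hermitian star_add)

lemma ip_scaleC': "ip (c *\<^sub>C x) y = cnj c *\<^sub>C ip x y"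
  by (metis ip_scaleC ip_hermitian star_scaleC)

lemma ip_scaleR': "ip (r *\<^sub>R x) y = r *\<^sub>R ip x y"
  by (simp add: scaleR_scaleC ip_scaleC')

lemma ip_zero' [simp]: "ip 0 x = 0"
  using ip_scaleR'[of 0 0 x] by simp

lemma ip_minus': "ip (- x) y = - ip x y"
  using ip_scaleR'[of "- 1" x y] by simp

lemma ip_diff': "ip (x - y) z = ip x z - ip y z"
  using ip_add'[of x "- y" z] by (simp add: ip_minus')

lemmas ip_simps = ip_add ip_add' ip_diff ip_diff' ip_scaleR ip_scaleR' ip_minus ip_minus'

lemma ip_eq_zero: "ip x x = 0 \<Longrightarrow> x = 0"
  using norm_form[of x] by simp

lemma ip_eqI:
  assumes "\<And>z. ip x z = ip y z"
  shows "x = y"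
  using assms[of "x - y"] ip_eq_zero[of "x - y"] by (simp add: ip_diff')

lemma ip_eqI':
  assumes "\<And>z. ip z x = ip z y"
  shows "x = y"
  by (rule ip_eqI) (metis assms ip_hermitian)

text \<open>Polarization replaces the Cauchy-Schwarz inequality, whose proof would use positivity. The
  constant is worse, but any bound gives continuity of the form.\<close>

lemma norm_ip_unit:
  assumes "norm x = 1" "norm y = 1"
  shows "norm (ip x y) \<le> 6"
proof -
  define a where "a = ip (x + y) (x + y) - ip x x - ip y y"
  define b where "b = ip (x + \<i> *\<^sub>C y) (x + \<i> *\<^sub>C y) - ip x x - ip y y"
  have a: "a = ip x y + ip y x" by (simp add: a_def ip_add ip_add')
  have ii: "\<i> *\<^sub>C \<i> *\<^sub>C z = - z" for z :: 'a
    by (simp add: scaleC_scaleC scaleC_minus_left scaleC_one)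
  have b: "b = \<i> *\<^sub>C ip x y - \<i> *\<^sub>C ip y x"
    by (simp add: b_def ip_add ip_add' ip_scaleC ip_scaleC' scaleC_add_right scaleC_diff_right scaleC_minus_left scaleC_minus_right ii)
  have "\<i> *\<^sub>C b = ip y x - ip x y"
    by (simp add: b scaleC_diff_right ii)
  hence "2 *\<^sub>R ip x y = a - \<i> *\<^sub>C b" by (simp add: a scaleR_2)
  hence "2 * norm (ip x y) = norm (a - \<i> *\<^sub>C b)" by (metis abs_numeral norm_scaleR)
  also have "\<dots> \<le> norm a + norm b"
    using norm_triangle_ineq4[of a "\<i> *\<^sub>C b"] by (simp add: norm_scaleC)
  finally have le: "2 * norm (ip x y) \<le> norm a + norm b" .
  have Q: "norm (ip (x + z) (x + z) - ip x x - ip y y) \<le> 6" if "norm z = 1" for z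
  proof -
    have "norm (x + z) \<le> 2" using norm_triangle_ineq[of x z] assms that by simp
    hence "norm (ip (x + z) (x + z)) \<le> 2\<^sup>2" unfolding norm_form by (rule power_mono) simp
    moreover have "norm (ip (x + z) (x + z) - ip x x - ip y y) \<le> norm (ip (x + z) (x + z)) + norm (ip x x) + norm (ip y y)"
      by (meson add_mono norm_triangle_ineq4 order_refl order_trans)
    ultimately show ?thesis using assms by (simp add: norm_form)
  qed
  show ?thesis using le Q[of y] Q[of "\<i> *\<^sub>C y"] assms by (simp add: a_def b_def norm_scaleC)
qed

lemma norm_ip_le: "norm (ip x y) \<le> 6 * norm x * norm y"
proof (cases "x = 0 \<or> y = 0")
  case False
  have "norm (ip ((1 / norm x) *\<^sub>R x) ((1 / norm y) *\<^sub>R y)) \<le> 6"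
    by (rule norm_ip_unit) (use False in auto)
  thus ?thesis using False by (simp add: ip_simps field_simps)
qed auto

lemma bounded_bilinear_ip: "bounded_bilinear ip"
  by (rule bounded_bilinear.intro)
     (auto simp: ip_simps intro!: exI[of _ 6] order_trans[OF norm_ip_le])

lemmas tendsto_ip = bounded_bilinear.tendsto[OF bounded_bilinear_ip]
lemmas continuous_on_ip = bounded_bilinear.continuous_on[OF bounded_bilinear_ip]

text \<open>The theorem of Hellinger and Toeplitz. The sets of those \<open>x\<close> for which
  \<open>\<parallel>\<langle>x, T' y\<rangle>\<parallel> \<le> n \<parallel>y\<parallel>\<close> for all \<open>y\<close> are closed and cover the space, so by Baire one of them contains a
  ball; testing with \<open>y = T x\<close> shows that \<open>T\<close> is bounded there.\<close>

lemma bounded_linear_if_adjoint: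
  assumes adj: "\<And>x y. ip (T x) y = ip x (T' y)"
  shows "bounded_linear T"
proof -
  have add: "T (x + y) = T x + T y" and scale: "T (r *\<^sub>R x) = r *\<^sub>R T x" for x y r
    by (rule ip_eqI; simp add: adj ip_simps)+
  hence lin: "linear T" by (rule linearI)
  define F where "F n = {x. \<forall>y. norm (ip x (T' y)) \<le> real n * norm y}" for n
  have closed: "closed (F n)" for n
    unfolding F_def
    by (intro closed_Collect_all closed_Collect_le continuous_on_norm continuous_on_ip
        continuous_on_id continuous_on_const)
  have cover: "\<exists>n. x \<in> F n" for x
  proof -
    obtain n where n: "6 * norm (T x) \<le> real n" using real_arch_simple by blast
    have "norm (ip x (T' y)) \<le> real n * norm y" for y
      using norm_ip_le[of "T x" y] mult_right_mono[OF n, of "norm y"] by (simp add: adj)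
    thus ?thesis by (auto simp: F_def)
  qed
  have F_bound: "norm (T x) \<le> real n" if "x \<in> F n" for x n
  proof (cases "T x = 0")
    case False
    have "norm (ip x (T' (T x))) \<le> real n * norm (T x)" using that by (simp add: F_def)
    hence "norm (T x) * norm (T x) \<le> real n * norm (T x)"
      using norm_form[of "T x"] by (metis adj power2_eq_square)
    thus ?thesis using False by simp
  qed simp
  have "\<exists>n. interior (F n) \<noteq> {}"
  proof (rule ccontr)
    assume "\<not> ?thesis"
    hence empty: "interior (F n) = {}" for n by simp
    have "mcomplete_of (euclidean_metric :: 'h metric)"
      by (auto simp: mcomplete_of_def Met_TC.mcomplete_def Cauchy_convergent_iff convergent_def)
    hence "interior (\<Union>(range F)) = {}"
      using Met_TC.metric_Baire_category_alt[where 'a='h, of "range F"] closed empty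
      by (auto simp: mcomplete_of_def)
    moreover have "\<Union>(range F) = UNIV" using cover by auto
    ultimately show False by auto
  qed
  then obtain n z where z: "z \<in> interior (F n)" by blast
  then obtain e where e: "e > 0" "cball z e \<subseteq> F n" by (meson mem_interior_cball)
  have *: "norm (T x) \<le> 2 * real n / e * norm x" for x
  proof (cases "x = 0")
    case True thus ?thesis using lin by (simp add: linear_0)
  next
    case False
    define w where "w = (e / norm x) *\<^sub>R x"
    have "norm w = e" using e False by (simp add: w_def)
    hence "z + w \<in> F n" "z \<in> F n" using e by (auto simp: subset_eq dist_norm)
    hence "norm (T (z + w)) \<le> n" "norm (T z) \<le> n" by (auto intro: F_bound)
    moreover have "T w = T (z + w) - T z" by (simp add: add)
    ultimately have "norm (T w) \<le> 2 * real n"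
      using norm_triangle_ineq4[of "T (z + w)" "T z"] by simp
    thus ?thesis using e False by (simp add: w_def scale field_simps)
  qed
  show ?thesis
    by (rule bounded_linear_intro[where K = "2 * real n / e"])
       (use * in \<open>simp_all add: add scale mult.commute[of "norm _"]\<close>)
qed

definition selfadjoint :: "('h \<Rightarrow> 'h) \<Rightarrow> bool" where
  "selfadjoint T \<longleftrightarrow> (\<forall>x y. ip (T x) y = ip x (T y))"

lemma selfadjointD: "selfadjoint T \<Longrightarrow> ip (T x) y = ip x (T y)"
  by (simp add: selfadjoint_def)

lemma selfadjoint_bounded_linear: "selfadjoint T \<Longrightarrow> bounded_linear T"
  by (rule bounded_linear_if_adjoint) (simp add: selfadjointD)

end

section \<open>Square roots without spectral theory\<close>

text \<open>Membership in the bicommutant, the substitute for being a function of the operator \<open>X\<close>: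
  it makes all operators constructed from the same \<open>X\<close> commute with each other.\<close>

definition bicommutes :: "('v::real_normed_vector \<Rightarrow> 'v) \<Rightarrow> ('v \<Rightarrow> 'v) \<Rightarrow> bool" where
  "bicommutes Y X \<longleftrightarrow> (\<forall>Z. bounded_linear Z \<longrightarrow> (\<forall>x. Z (X x) = X (Z x)) \<longrightarrow> (\<forall>x. Z (Y x) = Y (Z x)))"

lemma bicommutesD:
  "bicommutes Y X \<Longrightarrow> bounded_linear Z \<Longrightarrow> (\<And>x. Z (X x) = X (Z x)) \<Longrightarrow> Z (Y x) = Y (Z x)"
  by (simp add: bicommutes_def)

lemma bicommutes_commute:
  assumes "bicommutes Y X" "bicommutes Y' X" "bounded_linear X" "bounded_linear Y"
  shows "Y (Y' x) = Y' (Y x)"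
proof (rule bicommutesD[OF assms(2,4)])
  show "Y (X z) = X (Y z)" for z
    using bicommutesD[OF assms(1,3), of z] by simp
qed

lemma bicommutes_trans: "bicommutes Y X \<Longrightarrow> bicommutes X W \<Longrightarrow> bicommutes Y W"
  by (simp add: bicommutes_def)

lemma norm_apply_twice_le:
  fixes v :: "'v::real_normed_vector \<Rightarrow> 'v"
  assumes le: "\<And>x. norm (v x) \<le> sqrt q * norm x" and q: "q \<ge> 0"
  shows "norm (v (v x)) \<le> q * norm x"
proof -
  have "norm (v (v x)) \<le> sqrt q * (sqrt q * norm x)"
    using le[of "v x"] mult_left_mono[OF le[of x], of "sqrt q"] q
    by (meson order_trans real_sqrt_ge_zero)
  thus ?thesis using q by (simp flip: mult.assoc)
qed

context hermitian_form
begin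

text \<open>The equation says \<open>(1 - Y)\<^sup>2 = 1 - X\<close>. It is the fixed point equation
  \<open>Y = (X + Y\<^sup>2) / 2\<close>, whose right-hand side is a contraction with factor \<open>r\<close> of the ball of radius \<open>r\<close>.
  Selfadjointness and membership in the bicommutant survive the iteration, since they
  cut out a closed invariant subset of that ball.\<close>

lemma sqrt_one_minus:
  assumes X: "selfadjoint X" and le: "\<And>x. norm (X x) \<le> r * norm x" and r: "0 \<le> r" "r < 1"
  obtains Y where "selfadjoint Y" "\<And>x. norm (Y x) \<le> r * norm x"
    "\<And>x. 2 *\<^sub>R Y x - Y (Y x) = X x" "bicommutes Y X"
proof -
  define X' where "X' = Blinfun X"
  have X': "blinfun_apply X' = X"
    unfolding X'_def by (rule bounded_linear_Blinfun_apply) (rule selfadjoint_bounded_linear[OF X])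
  have nX': "norm X' \<le> r" by (rule norm_blinfun_bound) (use r le in \<open>simp_all add: X'\<close>)
  define S :: "('h \<Rightarrow>\<^sub>L 'h) set" where
    "S = {Y :: 'h \<Rightarrow>\<^sub>L 'h. norm Y \<le> r \<and> (\<forall>x y. ip (blinfun_apply Y x) y = ip x (blinfun_apply Y y)) \<and>
       (\<forall>Z::'h \<Rightarrow>\<^sub>L 'h. (\<forall>x. blinfun_apply Z (X x) = X (blinfun_apply Z x)) \<longrightarrow> (\<forall>x. blinfun_apply Z (blinfun_apply Y x) = blinfun_apply Y (blinfun_apply Z x)))}"
  define f where "f Y = (1/2) *\<^sub>R (X' + (Y o\<^sub>L Y))" for Y
  have f_apply: "f Y x = (1/2) *\<^sub>R (X x + Y (Y x))" for Y x
    by (simp add: f_def X' blinfun.bilinear_simps)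
  have closed: "closed S"
    unfolding S_def
    by (intro closed_Collect_conj closed_Collect_all closed_Collect_imp open_Collect_const
        closed_Collect_le closed_Collect_eq continuous_on_ip continuous_intros)
  have "f Y \<in> S" if Y: "Y \<in> S" for Y
  proof -
    have "norm Y * norm Y \<le> r * 1"
      using Y r by (intro mult_mono) (auto simp: S_def)
    hence "norm (X' + (Y o\<^sub>L Y)) \<le> r + r"
      using nX' norm_blinfun_compose[of Y Y] by (intro norm_triangle_mono) auto
    hence "norm (f Y) \<le> r" by (simp add: f_def)
    moreover have "ip (f Y x) y = ip x (f Y y)" for x y
      using Y by (simp add: f_apply ip_simps S_def selfadjointD[OF X])
    moreover have "Z (f Y x) = f Y (Z x)" if "\<forall>x. Z (X x) = X (Z x)" for Z :: "'h \<Rightarrow>\<^sub>L 'h" and x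
    proof -
      have "\<forall>x. Z (Y x) = Y (Z x)" using Y that by (simp add: S_def)
      thus ?thesis using that by (simp add: f_apply blinfun.bilinear_simps)
    qed
    ultimately show ?thesis by (simp add: S_def)
  qed
  moreover have "dist (f Y) (f Z) \<le> r * dist Y Z" if "Y \<in> S" "Z \<in> S" for Y Z
  proof -
    have "f Y - f Z = (1/2) *\<^sub>R ((Y o\<^sub>L (Y - Z)) + ((Y - Z) o\<^sub>L Z))"
      by (rule blinfun_eqI) (simp add: f_apply blinfun.bilinear_simps algebra_simps)
    moreover have "norm ((Y o\<^sub>L (Y - Z)) + ((Y - Z) o\<^sub>L Z)) \<le> r * norm (Y - Z) + r * norm (Y - Z)"
    proof (rule norm_triangle_mono)
      show "norm (Y o\<^sub>L (Y - Z)) \<le> r * norm (Y - Z)"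
        using that by (intro order_trans[OF norm_blinfun_compose] mult_right_mono) (auto simp: S_def)
      show "norm ((Y - Z) o\<^sub>L Z) \<le> r * norm (Y - Z)"
        using that by (subst mult.commute, intro order_trans[OF norm_blinfun_compose] mult_left_mono) (auto simp: S_def)
    qed
    ultimately show ?thesis by (simp add: dist_norm)
  qed
  moreover have "S \<noteq> {}"
  proof -
    have "0 \<in> S" using r by (simp add: S_def blinfun.bilinear_simps)
    thus ?thesis by blast
  qed
  ultimately obtain Y where Y: "Y \<in> S" "f Y = Y"
    using Banach_fix[of S r f] closed r by (auto simp: complete_eq_closed)
  show ?thesis
  proof
    show "selfadjoint (blinfun_apply Y)" using Y by (simp add: S_def selfadjoint_def)
    show "norm (Y x) \<le> r * norm x" for x
      using Y by (intro order_trans[OF norm_blinfun] mult_right_mono) (auto simp: S_def)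
    have "2 *\<^sub>R f Y x = X x + Y (Y x)" for x by (simp add: f_apply)
    thus "2 *\<^sub>R Y x - Y (Y x) = X x" for x using Y by simp
    show "bicommutes (blinfun_apply Y) X"
      unfolding bicommutes_def
    proof (intro allI impI)
      fix Z x assume Z: "bounded_linear Z" "\<forall>x. Z (X x) = X (Z x)"
      note Z_apply = bounded_linear_Blinfun_apply[OF Z(1)]
      have "\<forall>x. Blinfun Z (X x) = X (Blinfun Z x)" using Z by (simp add: Z_apply)
      hence "\<forall>x. Blinfun Z (Y x) = Y (Blinfun Z x)" using Y by (simp add: S_def)
      thus "Z (Y x) = Y (Z x)" by (simp add: Z_apply)
    qed
  qed
qed

lemma sqrt_shift:
  assumes X: "selfadjoint X" and le: "\<And>x. norm (X x) \<le> r * norm x" and r: "0 \<le> r" "r < m"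
  obtains K where "selfadjoint K" "\<And>x. K (K x) = m *\<^sub>R x - X x" "bicommutes K X"
proof -
  have m: "m > 0" using r by simp
  have "selfadjoint (\<lambda>x. (1/m) *\<^sub>R X x)" using X by (simp add: selfadjoint_def ip_simps)
  moreover have "norm ((1/m) *\<^sub>R X x) \<le> r / m * norm x" for x
    using le[of x] m by (simp add: field_simps)
  ultimately obtain Y where Y: "selfadjoint Y" "\<And>x. 2 *\<^sub>R Y x - Y (Y x) = (1/m) *\<^sub>R X x"
    "bicommutes Y (\<lambda>x. (1/m) *\<^sub>R X x)"
    by (rule sqrt_one_minus[of "\<lambda>x. (1/m) *\<^sub>R X x" "r / m"]) (use r m in auto)
  define K where "K x = sqrt m *\<^sub>R (x - Y x)" for x
  interpret Y: bounded_linear Y by (rule selfadjoint_bounded_linear[OF Y(1)])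
  show ?thesis
  proof
    show "selfadjoint K"
      using Y(1) by (simp add: K_def selfadjoint_def ip_simps)
    show "K (K x) = m *\<^sub>R x - X x" for x
    proof -
      have "K (K x) = m *\<^sub>R (x - (2 *\<^sub>R Y x - Y (Y x)))"
        using m by (simp add: K_def Y.scaleR Y.diff algebra_simps scaleR_2)
      also have "\<dots> = m *\<^sub>R x - X x" using m unfolding Y(2) by (simp add: scaleR_right_diff_distrib)
      finally show ?thesis .
    qed
    show "bicommutes K X"
      unfolding bicommutes_def
    proof (intro allI impI)
      fix Z x assume Z: "bounded_linear Z" "\<forall>x. Z (X x) = X (Z x)"
      interpret Z: bounded_linear Z by fact
      have "Z (Y x) = Y (Z x)" by (rule bicommutesD[OF Y(3) Z(1)]) (simp add: Z.scaleR Z(2))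
      thus "Z (K x) = K (Z x)" by (simp add: K_def Z.scaleR Z.diff)
    qed
  qed
qed

text \<open>Both operators \<open>u = v \<plusminus> i k\<close> satisfy \<open>\<langle>u x, u x\<rangle> = \<langle>v x, v x\<rangle> + \<langle>k x, k x\<rangle>\<close>, because the cross terms
  cancel when \<open>v\<close> and \<open>k\<close> commute; and \<open>v\<close> is their mean. For commuting operators this gives
  the monotonicity of the norm on sums of squares that positivity gives in general.\<close>

lemma norm_le_commuting_sum:
  assumes v: "selfadjoint v" and k: "selfadjoint k" and comm: "\<And>x. v (k x) = k (v x)"
  shows "(norm (v x))\<^sup>2 \<le> norm (ip (v x) (v x) + ip (k x) (k x))"
proof -
  let ?s = "ip (v x) (v x) + ip (k x) (k x)"
  have cross: "ip (k x) (v x) = ip (v x) (k x)"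
    by (simp add: selfadjointD[OF v] selfadjointD[OF k] comm)
  have ii: "\<i> *\<^sub>C \<i> *\<^sub>C z = - z" for z :: 'a
    by (simp add: scaleC_scaleC scaleC_minus_left scaleC_one)
  have "ip (v x + \<i> *\<^sub>C k x) (v x + \<i> *\<^sub>C k x) = ?s" "ip (v x - \<i> *\<^sub>C k x) (v x - \<i> *\<^sub>C k x) = ?s"
    by (simp_all add: ip_simps ip_scaleC ip_scaleC' cross scaleC_minus_left scaleC_add_right scaleC_diff_right ii)
  hence "(norm (v x + \<i> *\<^sub>C k x))\<^sup>2 = norm ?s" "(norm (v x - \<i> *\<^sub>C k x))\<^sup>2 = norm ?s"
    by (metis norm_form)+
  hence "norm (v x + \<i> *\<^sub>C k x) = sqrt (norm ?s)" "norm (v x - \<i> *\<^sub>C k x) = sqrt (norm ?s)"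
    by (metis norm_ge_zero real_sqrt_unique)+
  moreover have "2 *\<^sub>R v x = (v x + \<i> *\<^sub>C k x) + (v x - \<i> *\<^sub>C k x)" by (simp add: scaleR_2)
  hence "2 * norm (v x) = norm ((v x + \<i> *\<^sub>C k x) + (v x - \<i> *\<^sub>C k x))"
    by (metis abs_numeral norm_scaleR)
  ultimately have "norm (v x) \<le> sqrt (norm ?s)"
    using norm_triangle_ineq[of "v x + \<i> *\<^sub>C k x" "v x - \<i> *\<^sub>C k x"] by simp
  thus ?thesis by (metis norm_ge_zero real_le_rsqrt power_mono real_sqrt_pow2)
qed

lemma selfadjoint_inv:
  assumes G: "selfadjoint G" "bij G"
  shows "selfadjoint (inv G)"
  unfolding selfadjoint_def
  by (metis G selfadjointD bij_inv_eq_iff)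

text \<open>An elementary replacement for the equality of norm and spectral radius: if no negative real
  number lies in the spectrum of \<open>R\<close>, then \<open>0 \<le> R \<le> t\<close> in the sense that \<open>\<parallel>t - R\<parallel> \<le> t\<close>.

  Let \<open>h = t - R\<close> and suppose that \<open>m = \<parallel>h\<parallel>\<close> exceeds \<open>t\<close>. Then \<open>G = m - h = R + (m - t)\<close> has an
  inverse \<open>D\<close>. Take \<open>C > \<parallel>D\<parallel>\<close>. The three operators \<open>C - D = f\<^sup>2\<close>, \<open>m + e - h = c\<^sup>2\<close> and
  \<open>h + e = t + e - R = b\<^sup>2\<close> are squares of commuting selfadjoint operators, and
  \<open>C b\<^sup>2 + (c f)\<^sup>2 = C m - 1 + C e + e f\<^sup>2\<close>. Dropping the square \<open>(c f)\<^sup>2\<close> bounds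
  \<open>\<parallel>h\<parallel>\<close> by \<open>m - 1/C + O(e)\<close>, which is less than \<open>m\<close> for small \<open>e\<close>.\<close>

lemma shift_contraction:
  assumes R: "selfadjoint R" and bij: "\<And>l. l > 0 \<Longrightarrow> bij (\<lambda>x. R x + l *\<^sub>R x)"
    and t: "\<And>x. norm (R x) \<le> t * norm x" "0 \<le> t"
  shows "norm (t *\<^sub>R x - R x) \<le> t * norm x"
proof -
  define h where "h x = t *\<^sub>R x - R x" for x
  have h: "selfadjoint h" using R by (simp add: h_def selfadjoint_def ip_simps)
  note h_bl = selfadjoint_bounded_linear[OF h]
  define m where "m = onorm h"
  have hm: "norm (h x) \<le> m * norm x" for x unfolding m_def by (rule onorm[OF h_bl])
  have "m \<le> t"
  proof (rule ccontr)
    assume "\<not> m \<le> t"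
    hence mt: "m > t" by simp
    hence m: "m > 0" using t by simp
    define G where "G x = R x + (m - t) *\<^sub>R x" for x
    have G: "selfadjoint G" using R by (simp add: G_def selfadjoint_def ip_simps)
    have bijG: "bij G" unfolding G_def using bij mt by simp
    have G_eq: "G x = m *\<^sub>R x - h x" for x by (simp add: G_def h_def algebra_simps)
    define D where "D = inv G"
    have D: "selfadjoint D" unfolding D_def by (rule selfadjoint_inv[OF G bijG])
    have GD: "G (D x) = x" for x using bijG by (simp add: D_def bij_is_surj surj_f_inv_f)
    have DG: "D (G x) = x" for x using bijG by (simp add: D_def bij_is_inj)
    note D_bl = selfadjoint_bounded_linear[OF D]
    \<comment> \<open>The summand \<open>1 / m\<close> makes \<open>C m - 1\<close> nonnegative, so that it is its own norm below.\<close>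
    define C where "C = onorm D + 1 + 1 / m"
    have "onorm D \<ge> 0" by (rule onorm_pos_le[OF D_bl])
    hence C: "C > onorm D" "C > 0" "C * m \<ge> 1"
      using m by (simp_all add: C_def distrib_right add_nonneg_pos add_pos_pos)
    have D_comm: "bicommutes D R"
      unfolding bicommutes_def
    proof (intro allI impI)
      fix Z x assume Z: "bounded_linear Z" "\<forall>x. Z (R x) = R (Z x)"
      interpret Z: bounded_linear Z by fact
      have "Z (G x) = G (Z x)" for x by (simp add: G_def Z.add Z.scaleR Z(2))
      thus "Z (D x) = D (Z x)" by (metis GD DG)
    qed
    obtain f where f: "selfadjoint f" "\<And>x. f (f x) = C *\<^sub>R x - D x" "bicommutes f D"
      using sqrt_shift[OF D onorm[OF D_bl] onorm_pos_le[OF D_bl] C(1)] by blast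
    note f_bl = selfadjoint_bounded_linear[OF f(1)]
    have f_comm: "bicommutes f R" by (rule bicommutes_trans[OF f(3) D_comm])
    define F where "F = (onorm f)\<^sup>2"
    have fF: "(norm (f x))\<^sup>2 \<le> F * (norm x)\<^sup>2" for x
      unfolding F_def power_mult_distrib[symmetric] by (intro power_mono onorm[OF f_bl]) auto
    have F: "F \<ge> 0" by (simp add: F_def)
    \<comment> \<open>The error term in the final estimate is \<open>e (2 C + F) / C\<close>; this choice makes it half of the gain \<open>1 / C\<close>.\<close>
    define e where "e = 1 / (2 * (2 * C + F))"
    have e: "e > 0" using C F by (simp add: e_def add_pos_nonneg)
    obtain c where c: "selfadjoint c" "\<And>x. c (c x) = (m + e) *\<^sub>R x - h x" "bicommutes c h"
      using sqrt_shift[OF h hm, of "m + e"] m e by auto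
    have "bicommutes h R"
      unfolding bicommutes_def
    proof (intro allI impI)
      fix Z x assume Z: "bounded_linear Z" "\<forall>x. Z (R x) = R (Z x)"
      interpret Z: bounded_linear Z by fact
      show "Z (h x) = h (Z x)" by (simp add: h_def Z.diff Z.scaleR Z(2))
    qed
    hence c_comm: "bicommutes c R" using c(3) bicommutes_trans by blast
    obtain b where b: "selfadjoint b" "\<And>x. b (b x) = (t + e) *\<^sub>R x - R x" "bicommutes b R"
      using sqrt_shift[OF R t, of "t + e"] e by auto
    note R_bl = selfadjoint_bounded_linear[OF R]
    note c_bl = selfadjoint_bounded_linear[OF c(1)]
    note b_bl = selfadjoint_bounded_linear[OF b(1)]
    interpret c: bounded_linear c by (rule c_bl)
    interpret b: bounded_linear b by (rule b_bl)
    interpret f: bounded_linear f by (rule f_bl)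
    have cf: "c (f x) = f (c x)" for x by (rule bicommutes_commute[OF c_comm f_comm R_bl c_bl])
    have bf: "b (f x) = f (b x)" for x by (rule bicommutes_commute[OF b(3) f_comm R_bl b_bl])
    have bc: "b (c x) = c (b x)" for x by (rule bicommutes_commute[OF b(3) c_comm R_bl b_bl])
    define g where "g x = c (f x)" for x
    define v where "v x = sqrt C *\<^sub>R b x" for x
    have g: "selfadjoint g"
      unfolding selfadjoint_def g_def
      by (metis cf selfadjointD[OF c(1)] selfadjointD[OF f(1)])
    have v: "selfadjoint v" using b(1) by (simp add: v_def selfadjoint_def ip_simps)
    have sum: "v (v x) + g (g x) = (C * m - 1 + C * e) *\<^sub>R x + e *\<^sub>R f (f x)" for x
    proof -
      have "g (g x) = c (c (f (f x)))" by (simp add: g_def cf)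
      also have "\<dots> = G (f (f x)) + e *\<^sub>R f (f x)" by (simp add: c(2) G_eq algebra_simps)
      also have "G (f (f x)) = C *\<^sub>R G x - x"
      proof -
        have "bounded_linear G" by (rule selfadjoint_bounded_linear[OF G])
        then interpret G: bounded_linear G .
        show ?thesis by (simp add: f(2) G.diff G.scaleR GD)
      qed
      finally have gg: "g (g x) = C *\<^sub>R G x - x + e *\<^sub>R f (f x)" .
      have vv: "v (v x) = C *\<^sub>R ((t + e) *\<^sub>R x - R x)"
        using C by (simp add: v_def b.scaleR b(2))
      show ?thesis unfolding gg vv G_def by (simp add: algebra_simps)
    qed
    have vb: "(norm (v x))\<^sup>2 \<le> (C * m - 1 + C * e + e * F) * (norm x)\<^sup>2" for x
    proof -
      have "ip (v x) (v x) + ip (g x) (g x) = ip x (v (v x) + g (g x))"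
        by (simp add: selfadjointD[OF v] selfadjointD[OF g] ip_simps)
      also have "\<dots> = (C * m - 1 + C * e) *\<^sub>R ip x x + e *\<^sub>R ip (f x) (f x)"
        by (simp add: sum ip_simps selfadjointD[OF f(1)])
      finally have "(norm (v x))\<^sup>2 \<le> norm ((C * m - 1 + C * e) *\<^sub>R ip x x + e *\<^sub>R ip (f x) (f x))"
        using norm_le_commuting_sum[OF v g, of x] by (simp add: v_def g_def bc bf c.scaleR
            f.scaleR)
      also have "\<dots> \<le> (C * m - 1 + C * e) * (norm x)\<^sup>2 + e * (F * (norm x)\<^sup>2)"
        by (intro norm_triangle_mono) (use C e fF[of x] in \<open>simp_all add: norm_form\<close>)
      finally show ?thesis by (simp add: algebra_simps)
    qed
    define q where "q = C * m - 1 + C * e + e * F"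
    have "C * e > 0" "e * F \<ge> 0" using C e F by simp_all
    hence q: "q \<ge> 0" using \<open>C * m \<ge> 1\<close> unfolding q_def by linarith
    have vb': "norm (v x) \<le> sqrt q * norm x" for x
    proof (rule power2_le_imp_le)
      show "(norm (v x))\<^sup>2 \<le> (sqrt q * norm x)\<^sup>2"
        using vb[of x] q unfolding q_def[symmetric] by (simp add: power_mult_distrib)
    qed (use q in simp)
    have "C * norm (h x) \<le> (q + C * e) * norm x" for x
    proof -
      have "C *\<^sub>R h x = v (v x) - (C * e) *\<^sub>R x"
        using C by (simp add: v_def b.scaleR b(2) h_def algebra_simps)
      hence "norm (C *\<^sub>R h x) \<le> norm (v (v x)) + norm ((C * e) *\<^sub>R x)"
        by (simp only: norm_triangle_ineq4)
      moreover have "norm (v (v x)) \<le> q * norm x" by (rule norm_apply_twice_le[OF vb' q])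
      moreover have "norm ((C * e) *\<^sub>R x) = C * e * norm x" using \<open>C * e > 0\<close> by simp
      moreover have "norm (C *\<^sub>R h x) = C * norm (h x)" using C(2) by simp
      ultimately show ?thesis by (simp only: distrib_right)
    qed
    hence "norm (h x) \<le> (q + C * e) / C * norm x" for x
      using C(2) by (simp add: pos_le_divide_eq mult.commute)
    hence "m \<le> (q + C * e) / C"
      unfolding m_def using C(2) \<open>C * e > 0\<close> q by (intro onorm_bound) simp_all
    hence "m * C \<le> q + C * e" using C(2) by (simp add: pos_le_divide_eq)
    hence "1 \<le> e * (2 * C + F)" by (simp add: q_def algebra_simps)
    moreover have "2 * C + F > 0" using C(2) F by linarith
    hence "e * (2 * C + F) = 1 / 2" by (simp add: e_def)
    ultimately show False by simp
  qed
  thus ?thesis using hm[of x] mult_right_mono[of m t "norm x"] by (simp add: h_def)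
qed

end

section \<open>Positive elements of the algebra\<close>

interpretation algebra_form: hermitian_form "\<lambda>a b::'a::cstar_algebra. a\<^sup>\<star> * b"
  by unfold_locales (simp_all add: distrib_left mult_scaleC_right star_mult star_star cstar_identity)

text \<open>\<open>\<parallel>t - p\<parallel> \<le> t\<close> in the algebra of multipliers, spelled out with left multiplication as the algebra
  need not have a unit. For selfadjoint \<open>p\<close> and \<open>t \<ge> \<parallel>p\<parallel>\<close> it expresses positivity, and unlike the spectral
  definition it visibly passes to sums and limits.\<close>

definition positive_within :: "real \<Rightarrow> 'a::cstar_algebra \<Rightarrow> bool" where
  "positive_within t p \<longleftrightarrow> p\<^sup>\<star> = p \<and> (\<forall>a. norm (t *\<^sub>R a - p * a) \<le> t * norm a)"

lemma positive_within_mono: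
  assumes "positive_within s p" "s \<le> t"
  shows "positive_within t p"
  unfolding positive_within_def
proof (intro conjI allI)
  fix a
  have "norm (t *\<^sub>R a - p * a) = norm ((s *\<^sub>R a - p * a) + (t - s) *\<^sub>R a)" by (simp add: algebra_simps)
  also have "\<dots> \<le> s * norm a + (t - s) * norm a"
    by (rule norm_triangle_mono) (use assms in \<open>simp_all add: positive_within_def\<close>)
  finally show "norm (t *\<^sub>R a - p * a) \<le> t * norm a" by (simp add: algebra_simps)
qed (use assms in \<open>simp add: positive_within_def\<close>)

lemma positive_within_add:
  assumes "positive_within s p" "positive_within t q"
  shows "positive_within (s + t) (p + q)"
  unfolding positive_within_def
proof (intro conjI allI)
  fix a
  have "norm ((s + t) *\<^sub>R a - (p + q) * a) = norm ((s *\<^sub>R a - p * a) + (t *\<^sub>R a - q * a))"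
    by (simp add: algebra_simps)
  also have "\<dots> \<le> s * norm a + t * norm a"
    by (rule norm_triangle_mono) (use assms in \<open>simp_all add: positive_within_def\<close>)
  finally show "norm ((s + t) *\<^sub>R a - (p + q) * a) \<le> (s + t) * norm a" by (simp add: algebra_simps)
qed (use assms in \<open>simp add: positive_within_def star_add\<close>)

lemma positive_within_scaleR:
  assumes "positive_within t p" "r \<ge> 0"
  shows "positive_within (r * t) (r *\<^sub>R p)"
  unfolding positive_within_def
proof (intro conjI allI)
  fix a
  have "norm ((r * t) *\<^sub>R a - r *\<^sub>R p * a) = norm (r *\<^sub>R (t *\<^sub>R a - p * a))"
    by (simp add: algebra_simps)
  also have "\<dots> \<le> r * (t * norm a)"
    using assms by (simp add: positive_within_def mult_left_mono del: scaleR_diff_right)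
  finally show "norm ((r * t) *\<^sub>R a - r *\<^sub>R p * a) \<le> r * t * norm a" by simp
qed (use assms in \<open>simp add: positive_within_def star_scaleR\<close>)

lemma positive_within_limit:
  assumes lim: "p \<longlonglongrightarrow> q" and p: "\<And>n. positive_within t (p n)"
  shows "positive_within t q"
  unfolding positive_within_def
proof (intro conjI allI)
  have "isCont star q" for q :: 'a
  proof -
    have "bounded_linear (star :: 'a \<Rightarrow> 'a)"
      by (rule bounded_linear_intro[where K = 1]) (simp_all add: star_add star_scaleR norm_star)
    thus ?thesis by (rule linear_continuous_at)
  qed
  hence "(\<lambda>n. star (p n)) \<longlonglongrightarrow> star q" using lim by (rule isCont_tendsto_compose)
  moreover have "star (p n) = p n" for n using p[of n] by (simp add: positive_within_def)
  ultimately show "star q = q" using lim by (simp add: LIMSEQ_unique)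
  fix a
  have "(\<lambda>n. norm (t *\<^sub>R a - p n * a)) \<longlonglongrightarrow> norm (t *\<^sub>R a - q * a)"
    by (intro tendsto_intros lim)
  thus "norm (t *\<^sub>R a - q * a) \<le> t * norm a"
    by (rule LIMSEQ_le_const2) (use p in \<open>auto simp: positive_within_def\<close>)
qed

lemma norm_le_left_mult:
  assumes "\<And>a. norm (q * a) \<le> s * norm a"
  shows "norm (q :: 'a::cstar_algebra) \<le> s \<or> q = 0"
proof -
  have "norm q * norm q \<le> s * norm q"
    using assms[of "q\<^sup>\<star>"] cstar_identity[of "q\<^sup>\<star>"]
    by (simp add: star_star norm_star power2_eq_square)
  thus ?thesis by auto
qed

text \<open>Quasi-invertibility of \<open>c = - p / l\<close> with quasi-inverse \<open>b\<close> means that multiplication by \<open>1 - b\<close> inverts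
  multiplication by \<open>1 - c\<close>, so that \<open>p + l\<close> acts bijectively on the algebra.\<close>

lemma positive_imp_positive_within:
  assumes p: "positive p" and t: "norm p \<le> t"
  shows "positive_within t p"
proof -
  have sa: "p\<^sup>\<star> = p" using p by (simp add: positive_def)
  have "norm (t *\<^sub>R a - p * a) \<le> t * norm a" for a
  proof (rule algebra_form.shift_contraction[where R = "\<lambda>a. p * a"])
    show "algebra_form.selfadjoint (\<lambda>a. p * a)"
      by (simp add: algebra_form.selfadjoint_def star_mult sa mult.assoc)
    show "norm (p * x) \<le> t * norm x" for x
      using norm_mult_ineq[of p x] mult_right_mono[OF t, of "norm x"] by simp
    show "0 \<le> t" using t norm_ge_zero order_trans by blast
    fix l :: real assume l: "l > 0"
    define c where "c = inverse (complex_of_real (- l)) *\<^sub>C p"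
    have "complex_of_real (- l) \<notin> spectrum p"
      using p l by (auto simp: positive_def complex_nonneg_Reals_iff)
    then obtain b where b: "c + b = c * b" "c + b = b * c"
      by (auto simp: spectrum_def quasi_invertible_def c_def)
    have pc: "p = - (l *\<^sub>R c)"
    proof -
      have "inverse (complex_of_real (- l)) = complex_of_real (- (1 / l))" by (simp add: inverse_eq_divide)
      hence "c = (- (1 / l)) *\<^sub>R p" unfolding c_def by (simp only: scaleC_of_real)
      thus ?thesis using l by simp
    qed
    have cb: "c * x + b * x = c * (b * x)" "c * x + b * x = b * (c * x)" for x
      using b by (metis distrib_right mult.assoc)+
    show "bij (\<lambda>x. p * x + l *\<^sub>R x)"
    proof (rule o_bij[where g = "\<lambda>x. (1 / l) *\<^sub>R (x - b * x)"])
      show "(\<lambda>x. (1 / l) *\<^sub>R (x - b * x)) \<circ> (\<lambda>x. p * x + l *\<^sub>R x) = id"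
        using l by (auto simp: fun_eq_iff pc right_diff_distrib distrib_left cb(2)[symmetric] algebra_simps)
      show "(\<lambda>x. p * x + l *\<^sub>R x) \<circ> (\<lambda>x. (1 / l) *\<^sub>R (x - b * x)) = id"
        using l by (auto simp: fun_eq_iff pc right_diff_distrib distrib_left cb(1)[symmetric] algebra_simps)
    qed
  qed
  thus ?thesis using sa by (simp add: positive_within_def)
qed

text \<open>Put \<open>\<rho> = \<parallel>p + q\<parallel>\<close>. From \<open>\<parallel>s - p\<parallel> \<le> s\<close> follows
  \<open>\<parallel>s + q\<parallel> \<le> s + \<rho>\<close>, so \<open>\<rho> + d - q = (s + \<rho> + d) - (s + q)\<close> is the square of some \<open>k\<close>, while
  \<open>q + d = (t + d) - (t - q)\<close> is the square of some \<open>v\<close>. These commute and \<open>v\<^sup>2 + k\<^sup>2 = \<rho> + 2 d\<close>, hence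
  \<open>\<parallel>v\<^sup>2\<parallel> \<le> \<rho> + 2 d\<close>.\<close>

lemma norm_le_add_positive:
  assumes p: "positive_within s p" and q: "positive_within t q"
  shows "norm q \<le> norm (p + q)"
proof -
  define s' where "s' = max s 0"
  define t' where "t' = max t 0"
  have p': "positive_within s' p" and q': "positive_within t' q"
    using p q by (auto intro: positive_within_mono simp: s'_def t'_def)
  have st: "s' \<ge> 0" "t' \<ge> 0" by (simp_all add: s'_def t'_def)
  define \<rho> where "\<rho> = norm (p + q)"
  have \<rho>: "\<rho> \<ge> 0" by (simp add: \<rho>_def)
  have sq: "q\<^sup>\<star> = q" using q by (simp add: positive_within_def)
  have "norm q \<le> \<rho> + e" if "e > 0" for e
  proof -
    \<comment> \<open>One \<open>d\<close> is lost in each of the two square roots, one more in passing from \<open>q + d\<close> to \<open>q\<close>.\<close>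
    define d where "d = e / 3"
    have d: "d > 0" using that by (simp add: d_def)
    have X1: "algebra_form.selfadjoint (\<lambda>a. t' *\<^sub>R a - q * a)"
      by (simp add: algebra_form.selfadjoint_def star_diff star_scaleR star_mult sq algebra_simps)
    obtain v where v: "algebra_form.selfadjoint v"
      "\<And>a. v (v a) = (t' + d) *\<^sub>R a - (t' *\<^sub>R a - q * a)" "bicommutes v (\<lambda>a. t' *\<^sub>R a - q * a)"
      by (rule algebra_form.sqrt_shift[OF X1, of t' "t' + d"])
         (use q' st d in \<open>auto simp: positive_within_def\<close>)
    have X2: "algebra_form.selfadjoint (\<lambda>a. s' *\<^sub>R a + q * a)"
      by (simp add: algebra_form.selfadjoint_def star_add star_scaleR star_mult sq algebra_simps)
    have le2: "norm (s' *\<^sub>R a + q * a) \<le> (s' + \<rho>) * norm a" for a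
    proof -
      have "s' *\<^sub>R a + q * a = (s' *\<^sub>R a - p * a) + (p + q) * a" by (simp add: algebra_simps)
      also have "norm \<dots> \<le> s' * norm a + \<rho> * norm a"
        by (rule norm_triangle_mono) (use p' in \<open>auto simp: positive_within_def \<rho>_def norm_mult_ineq\<close>)
      finally show ?thesis by (simp add: algebra_simps)
    qed
    obtain k where k: "algebra_form.selfadjoint k"
      "\<And>a. k (k a) = (s' + \<rho> + d) *\<^sub>R a - (s' *\<^sub>R a + q * a)" "bicommutes k (\<lambda>a. s' *\<^sub>R a + q * a)"
      by (rule algebra_form.sqrt_shift[OF X2 le2, of "s' + \<rho> + d"]) (use st d \<rho> in auto)
    have bl: "bounded_linear (\<lambda>a. q * a)" by (rule bounded_linear_mult_right)
    have "bicommutes (\<lambda>a. t' *\<^sub>R a - q * a) (\<lambda>a. q * a)" "bicommutes (\<lambda>a. s' *\<^sub>R a + q * a) (\<lambda>a. q * a)"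
      unfolding bicommutes_def
      by (simp_all add: linear_diff linear_add linear_scale bounded_linear.linear)
    hence vq: "bicommutes v (\<lambda>a. q * a)" and kq: "bicommutes k (\<lambda>a. q * a)"
      using v(3) k(3) bicommutes_trans by blast+
    note v_bl = algebra_form.selfadjoint_bounded_linear[OF v(1)]
    have vk: "v (k a) = k (v a)" for a by (rule bicommutes_commute[OF vq kq bl v_bl])
    have bound: "norm (v a) \<le> sqrt (\<rho> + 2 * d) * norm a" for a
    proof (rule power2_le_imp_le)
      have "(v a)\<^sup>\<star> * v a + (k a)\<^sup>\<star> * k a = a\<^sup>\<star> * (v (v a) + k (k a))"
        using algebra_form.selfadjointD[OF v(1), of a "v a"] algebra_form.selfadjointD[OF k(1), of a "k a"]
        by (simp add: distrib_left)
      also have "\<dots> = (\<rho> + 2 * d) *\<^sub>R (a\<^sup>\<star> * a)"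
        by (simp add: v(2) k(2) algebra_simps flip: scaleR_2)
      finally have "(norm (v a))\<^sup>2 \<le> norm ((\<rho> + 2 * d) *\<^sub>R (a\<^sup>\<star> * a))"
        using algebra_form.norm_le_commuting_sum[OF v(1) k(1) vk, of a] by simp
      thus "(norm (v a))\<^sup>2 \<le> (sqrt (\<rho> + 2 * d) * norm a)\<^sup>2"
        using d \<rho> by (simp add: cstar_identity power_mult_distrib)
    qed (use d \<rho> in simp)
    have "norm (q * a) \<le> (\<rho> + e) * norm a" for a
    proof -
      have "q * a = v (v a) - d *\<^sub>R a" by (simp add: v(2) algebra_simps)
      hence "norm (q * a) \<le> norm (v (v a)) + norm (d *\<^sub>R a)" by (metis norm_triangle_ineq4)
      moreover have "norm (v (v a)) \<le> (\<rho> + 2 * d) * norm a"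
        by (rule norm_apply_twice_le[OF bound]) (use d \<rho> in simp)
      ultimately show ?thesis using d by (simp add: d_def algebra_simps)
    qed
    thus ?thesis using norm_le_left_mult[of q "\<rho> + e"] that \<rho> by auto
  qed
  thus ?thesis unfolding \<rho>_def by (rule field_le_epsilon)
qed

section \<open>Positive operators on a Hilbert module\<close>

sublocale hilbert_module \<subseteq> hermitian_form ip
proof
  fix x
  show "norm (ip x x) = (norm x)\<^sup>2" by (simp add: norm_ip)
qed (rule ip_add_right ip_scaleC_right ip_star)+

context hilbert_module
begin

lemma positive_within_ip: "(norm x)\<^sup>2 \<le> t \<Longrightarrow> positive_within t \<langle>x, x\<rangle>"
  using positive_imp_positive_within[OF ip_positive, of x t] by (simp add: norm_form)

lemma norm_le_add_ip: "positive_within t p \<Longrightarrow> (norm x)\<^sup>2 \<le> norm (p + \<langle>x, x\<rangle>)"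
  using norm_le_add_positive[OF _ positive_within_ip[OF order_refl], of t p x] by (simp add: norm_form)

text \<open>Positivity of an operator tested on the values of its quadratic form. It turns out to be
  equivalent to the spectral notion, but is immediate for sums, limits and conjugates \<open>X\<^sup>\<dagger> A X\<close>.\<close>

definition form_positive :: "('h \<Rightarrow> 'h) \<Rightarrow> bool" where
  "form_positive A \<longleftrightarrow> selfadjoint A \<and> (\<forall>x. \<exists>t. positive_within t \<langle>x, A x\<rangle>)"

lemma form_positive_selfadjoint: "form_positive A \<Longrightarrow> selfadjoint A"
  by (simp add: form_positive_def)

lemma form_positiveE:
  assumes "form_positive A"
  obtains t where "positive_within t \<langle>x, A x\<rangle>"
  using assms by (auto simp: form_positive_def)

lemma form_positiveI_square:
  assumes "selfadjoint A" "\<And>x. \<langle>x, A x\<rangle> = \<langle>X x, X x\<rangle>"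
  shows "form_positive A"
  using assms positive_within_ip by (auto simp: form_positive_def)

lemma form_positive_scaleR:
  assumes "form_positive A" "r \<ge> 0"
  shows "form_positive (\<lambda>x. r *\<^sub>R A x)"
  unfolding form_positive_def
proof (intro conjI allI)
  show "selfadjoint (\<lambda>x. r *\<^sub>R A x)"
    using form_positive_selfadjoint[OF assms(1)] by (simp add: selfadjoint_def ip_simps)
  fix x
  obtain t where "positive_within t \<langle>x, A x\<rangle>" using assms(1) by (rule form_positiveE)
  from positive_within_scaleR[OF this assms(2)]
  show "\<exists>t. positive_within t \<langle>x, r *\<^sub>R A x\<rangle>" by (auto simp: ip_simps)
qed

text \<open>The difference \<open>\<langle>x, x\<rangle> - \<langle>(1 - A) x, (1 - A) x\<rangle>\<close> equals \<open>\<langle>x, A x\<rangle> + \<langle>x, A (1 - A) x\<rangle>\<close>. With \<open>1 - A = K\<^sup>2\<close> the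
  second summand is \<open>\<langle>K x, A K x\<rangle>\<close>, so both are positive and the norm is monotone.\<close>

lemma norm_minus_form_positive_le:
  assumes A: "form_positive A" and r: "\<And>x. norm (A x) \<le> r * norm x" "0 \<le> r" "r < 1"
  shows "norm (x - A x) \<le> norm x"
proof -
  have sa: "selfadjoint A" using A by (rule form_positive_selfadjoint)
  obtain K where K: "selfadjoint K" "\<And>x. K (K x) = 1 *\<^sub>R x - A x" "bicommutes K A"
    by (rule sqrt_shift[OF sa r]) auto
  interpret A: bounded_linear A by (rule selfadjoint_bounded_linear[OF sa])
  have AK: "A (K x) = K (A x)" for x
    by (rule bicommutesD[OF K(3)]) (simp_all add: A.bounded_linear_axioms)
  have "\<langle>K x, A (K x)\<rangle> = \<langle>x, A x\<rangle> - \<langle>x, A (A x)\<rangle>"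
    by (simp add: AK selfadjointD[OF K(1)] K(2) ip_simps)
  hence split: "\<langle>x, x\<rangle> = (\<langle>x, A x\<rangle> + \<langle>K x, A (K x)\<rangle>) + \<langle>x - A x, x - A x\<rangle>"
    by (simp add: ip_simps selfadjointD[OF sa])
  obtain s where "positive_within s \<langle>x, A x\<rangle>" using A by (rule form_positiveE)
  moreover obtain t where "positive_within t \<langle>K x, A (K x)\<rangle>" using A by (rule form_positiveE)
  ultimately have "positive_within (s + t) (\<langle>x, A x\<rangle> + \<langle>K x, A (K x)\<rangle>)" by (intro positive_within_add)
  from norm_le_add_ip[OF this, of "x - A x"] have "(norm (x - A x))\<^sup>2 \<le> norm \<langle>x, x\<rangle>"
    unfolding split .
  thus ?thesis unfolding norm_form by (rule power2_le_imp_le) simp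
qed

text \<open>For small \<open>c > 0\<close> the equation \<open>A x + t x = y\<close> is the fixed point equation
  \<open>(1 + c t) x = c y + (x - c A x)\<close>, and \<open>\<parallel>1 - c A\<parallel> \<le> 1\<close>.\<close>

lemma bij_form_positive_plus:
  assumes A: "form_positive A" and t: "t > 0"
  shows "bij (\<lambda>x. A x + t *\<^sub>R x)"
proof -
  interpret A: bounded_linear A
    by (rule selfadjoint_bounded_linear[OF form_positive_selfadjoint[OF A]])
  define N where "N = onorm A"
  have N: "N \<ge> 0" unfolding N_def by (rule onorm_pos_le[OF A.bounded_linear_axioms])
  have le: "norm (A x) \<le> N * norm x" for x unfolding N_def by (rule onorm[OF A.bounded_linear_axioms])
  define c where "c = 1 / (N + 1)"
  have c: "c > 0" "c * N < 1" using N by (simp_all add: c_def)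
  have fp: "form_positive (\<lambda>x. c *\<^sub>R A x)" using A c by (simp add: form_positive_scaleR)
  have contr: "norm (x - c *\<^sub>R A x) \<le> norm x" for x
    by (rule norm_minus_form_positive_le[OF fp, of "c * N"]) (use le c N in \<open>simp_all add: mult_left_mono\<close>)
  define q where "q = 1 / (1 + c * t)"
  have ct: "c * t > 0" using c t by simp
  hence q: "0 \<le> q" "q < 1" "q > 0" by (simp_all add: q_def)
  have "\<exists>!x. A x + t *\<^sub>R x = y" for y
  proof -
    define f where "f x = q *\<^sub>R (c *\<^sub>R y + (x - c *\<^sub>R A x))" for x
    have "f x - f z = q *\<^sub>R ((x - z) - c *\<^sub>R A (x - z))" for x z
      by (simp add: f_def A.diff algebra_simps)
    hence "dist (f x) (f z) \<le> q * dist x z" for x z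
      using contr[of "x - z"] q by (simp add: dist_norm mult_left_mono del: scaleR_diff_right)
    hence "\<exists>!x. f x = x" using q banach_fix_type[of q f] by blast
    moreover have "f x = x \<longleftrightarrow> A x + t *\<^sub>R x = y" for x
    proof -
      have "(1 + c * t) * q = 1" using ct by (simp add: q_def)
      hence "(1 + c * t) *\<^sub>R f x = c *\<^sub>R y + (x - c *\<^sub>R A x)" by (simp add: f_def)
      moreover have "f x = x \<longleftrightarrow> (1 + c * t) *\<^sub>R f x = (1 + c * t) *\<^sub>R x" using ct by simp
      ultimately have "f x = x \<longleftrightarrow> c *\<^sub>R y + (x - c *\<^sub>R A x) = (1 + c * t) *\<^sub>R x" by simp
      also have "\<dots> \<longleftrightarrow> c *\<^sub>R (A x + t *\<^sub>R x) = c *\<^sub>R y" by (auto simp: algebra_simps)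
      finally show ?thesis using c by simp
    qed
    ultimately show ?thesis by simp
  qed
  thus ?thesis by (simp add: bij_iff)
qed

lemma is_adjointD: "is_adjoint T T' \<Longrightarrow> \<langle>T x, y\<rangle> = \<langle>x, T' y\<rangle>"
  by (simp add: is_adjoint_def)

lemma is_adjoint_sym: "is_adjoint T T' \<Longrightarrow> is_adjoint T' T"
  unfolding is_adjoint_def by (metis ip_star)

lemma is_adjoint_unique: "is_adjoint T T' \<Longrightarrow> is_adjoint T T'' \<Longrightarrow> T' = T''"
  by (rule ext, rule ip_eqI') (simp add: is_adjoint_def)

lemma adj_eqI: "is_adjoint T T' \<Longrightarrow> T\<^sup>\<dagger> = T'"
  unfolding adj_def by (rule the_equality) (auto intro: is_adjoint_unique)

lemma is_adjoint_adj: "T \<in> \<L> \<Longrightarrow> is_adjoint T (T\<^sup>\<dagger>)"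
  unfolding adjointable_def using adj_eqI by force

lemma adjointableI: "is_adjoint T T' \<Longrightarrow> T \<in> \<L>"
  by (auto simp: adjointable_def)

lemma selfadjoint_iff: "selfadjoint T \<longleftrightarrow> T \<in> \<L> \<and> T\<^sup>\<dagger> = T"
proof
  assume "selfadjoint T"
  hence "is_adjoint T T" by (simp add: selfadjoint_def is_adjoint_def)
  thus "T \<in> \<L> \<and> T\<^sup>\<dagger> = T" using adj_eqI adjointableI by blast
next
  assume "T \<in> \<L> \<and> T\<^sup>\<dagger> = T"
  thus "selfadjoint T" using is_adjoint_adj[of T] by (simp add: selfadjoint_def is_adjoint_def)
qed

lemma selfadjoint_scaleC:
  assumes "selfadjoint A"
  shows "A (c *\<^sub>C x) = c *\<^sub>C A x"
  by (rule ip_eqI') (simp add: selfadjointD[OF assms, symmetric] ip_scaleC)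

text \<open>A negative \<open>l\<close> is covered by the bijectivity of \<open>A + t\<close>. For \<open>l = a + i b\<close> with \<open>b \<noteq> 0\<close>, the product of
  \<open>A - l\<close> and its adjoint is \<open>(A - a)\<^sup>2 + b\<^sup>2\<close>, a form positive operator plus a positive number, so
  it is bijective too.\<close>

lemma form_positive_resolvent:
  assumes A: "form_positive A" and l: "l \<notin> \<real>\<^sub>\<ge>\<^sub>0"
  shows "l \<notin> op_spectrum A"
proof -
  have sa: "selfadjoint A" using A by (rule form_positive_selfadjoint)
  interpret A: bounded_linear A by (rule selfadjoint_bounded_linear[OF sa])
  show ?thesis
  proof (cases "Im l = 0")
    case True
    define t where "t = - Re l"
    have l_eq: "l = complex_of_real (- t)" using True by (simp add: t_def complex_eq_iff)
    have t: "t > 0" using l True unfolding complex_nonneg_Reals_iff t_def by simp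
    define G where "G = (\<lambda>x. A x - l *\<^sub>C x)"
    have G_eq: "G = (\<lambda>x. A x + t *\<^sub>R x)" unfolding G_def l_eq scaleC_of_real by simp
    have bij: "bij G" unfolding G_eq by (rule bij_form_positive_plus[OF A t])
    have "selfadjoint G" using sa by (simp add: G_eq selfadjoint_def ip_simps)
    hence "inv G \<in> \<L>" using selfadjoint_inv[OF _ bij] selfadjoint_iff by blast
    moreover have "inv G \<circ> G = id" "G \<circ> inv G = id"
      using bij by (simp_all add: bij_is_inj bij_is_surj surj_iff[symmetric])
    ultimately show ?thesis unfolding op_spectrum_def G_def by blast
  next
    case False
    define a where "a = Re l"
    define b where "b = Im l"
    define G where "G = (\<lambda>x. A x - l *\<^sub>C x)"
    define G' where "G' = (\<lambda>x. A x - cnj l *\<^sub>C x)"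
    have GG': "is_adjoint G G'"
      unfolding is_adjoint_def G_def G'_def
      by (simp add: ip_simps ip_scaleC ip_scaleC' selfadjointD[OF sa])
    define B where "B = (\<lambda>x. A (A x - a *\<^sub>R x) - a *\<^sub>R (A x - a *\<^sub>R x))"
    define H where "H = (\<lambda>x. B x + b\<^sup>2 *\<^sub>R x)"
    have "form_positive B"
    proof (rule form_positiveI_square[where X = "\<lambda>x. A x - a *\<^sub>R x"])
      show "selfadjoint B" using sa by (simp add: B_def selfadjoint_def ip_simps A.diff A.scaleR)
      show "\<langle>x, B x\<rangle> = \<langle>A x - a *\<^sub>R x, A x - a *\<^sub>R x\<rangle>" for x
        by (simp add: B_def ip_simps A.diff A.scaleR selfadjointD[OF sa])
    qed
    moreover have "b\<^sup>2 > 0" using False by (simp add: b_def)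
    ultimately have bij: "bij H" unfolding H_def by (rule bij_form_positive_plus)
    have H_sa: "selfadjoint H"
      using sa by (simp add: H_def B_def selfadjoint_def ip_simps A.diff A.scaleR)
    define J where "J = inv H"
    have J: "J (H x) = x" "H (J x) = x" for x
      using bij by (simp_all add: J_def bij_is_inj bij_is_surj surj_f_inv_f)
    have J_sa: "selfadjoint J" unfolding J_def by (rule selfadjoint_inv[OF H_sa bij])
    have H_eq: "H x = A (A x) - (2 * a) *\<^sub>R A x + (a\<^sup>2 + b\<^sup>2) *\<^sub>R x" for x
      by (simp add: H_def B_def A.diff A.scaleR algebra_simps power2_eq_square flip: scaleR_2)
    have prod: "A (A x) - l *\<^sub>C A x - (cnj l *\<^sub>C A x - (cnj l * l) *\<^sub>C x) = H x" for x
    proof -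
      have "l *\<^sub>C A x + cnj l *\<^sub>C A x = (2 * a) *\<^sub>R A x"
        unfolding scaleC_add_left[symmetric] complex_add_cnj by (simp only: scaleC_of_real a_def)
      moreover have "cnj l * l = complex_of_real (a\<^sup>2 + b\<^sup>2)"
        by (simp add: a_def b_def complex_mult_cnj mult.commute)
      hence "(cnj l * l) *\<^sub>C x = (a\<^sup>2 + b\<^sup>2) *\<^sub>R x" by (simp only: scaleC_of_real)
      ultimately show ?thesis by (simp add: H_eq algebra_simps)
    qed
    have G'G: "G' (G x) = H x" for x
      using prod[of x] by (simp add: G_def G'_def A.diff selfadjoint_scaleC[OF sa] scaleC_diff_right scaleC_scaleC)
    have GG'_eq: "G (G' x) = H x" for x
      using prod[of x] by (simp add: G_def G'_def A.diff selfadjoint_scaleC[OF sa] scaleC_diff_right scaleC_scaleC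
        mult.commute algebra_simps)
    have "is_adjoint (J \<circ> G') (G \<circ> J)"
      using GG' J_sa by (simp add: is_adjoint_def selfadjoint_def) (metis ip_star)
    hence "J \<circ> G' \<in> \<L>" by (rule adjointableI)
    moreover have "(J \<circ> G') \<circ> G = id" by (simp add: fun_eq_iff G'G J)
    moreover have "G \<circ> (J \<circ> G') = id"
    proof
      fix x
      have "G (H y) = H (G y)" for y by (metis G'G GG'_eq)
      hence "G (J z) = J (G z)" for z by (metis J)
      thus "(G \<circ> (J \<circ> G')) x = id x" by (simp add: GG'_eq J)
    qed
    ultimately show ?thesis unfolding op_spectrum_def G_def by blast
  qed
qed

lemma form_positive_imp_positive_op: "form_positive A \<Longrightarrow> positive_op A"
  using form_positive_resolvent form_positive_selfadjoint selfadjoint_iff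
  unfolding positive_op_def by blast

text \<open>By the spectral condition \<open>\<parallel>t - R\<parallel> \<le> t\<close>, so \<open>R + e = (t + e) - (t - R)\<close> is the square of a selfadjoint \<open>w\<close> for
  every \<open>e > 0\<close>. Thus \<open>\<langle>x, R x\<rangle> + e \<langle>x, x\<rangle> = \<langle>w x, w x\<rangle>\<close> is positive, within a radius that does not depend
  on \<open>e \<le> 1\<close>, and \<open>e\<close> can tend to \<open>0\<close>.\<close>

lemma positive_op_imp_form_positive:
  assumes "positive_op R"
  shows "form_positive R"
proof -
  have R: "selfadjoint R" using assms by (simp add: positive_op_def selfadjoint_iff)
  note bl = selfadjoint_bounded_linear[OF R]
  define t where "t = onorm R"
  have t: "norm (R x) \<le> t * norm x" "0 \<le> t" for x
    unfolding t_def by (rule onorm[OF bl] onorm_pos_le[OF bl])+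
  have bij: "bij (\<lambda>x. R x + l *\<^sub>R x)" if "l > 0" for l
  proof -
    have "complex_of_real (- l) \<notin> op_spectrum R"
      using assms that by (auto simp: positive_op_def complex_nonneg_Reals_iff)
    moreover have "(\<lambda>x. R x - complex_of_real (- l) *\<^sub>C x) = (\<lambda>x. R x + l *\<^sub>R x)"
      by (simp only: scaleC_of_real) simp
    ultimately show ?thesis unfolding op_spectrum_def using o_bij by auto
  qed
  have contr: "norm (t *\<^sub>R x - R x) \<le> t * norm x" for x by (rule shift_contraction[OF R bij t])
  have sa: "selfadjoint (\<lambda>x. t *\<^sub>R x - R x)" using R by (simp add: selfadjoint_def ip_simps)
  have "\<exists>s. positive_within s \<langle>x, R x\<rangle>" for x
  proof
    define s where "s = norm \<langle>x, R x\<rangle> + (norm x)\<^sup>2"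
    define p where "p n = \<langle>x, R x\<rangle> + inverse (real (Suc n)) *\<^sub>R \<langle>x, x\<rangle>" for n
    have "(\<lambda>n. \<langle>x, R x\<rangle> + inverse (real (Suc n)) *\<^sub>R \<langle>x, x\<rangle>) \<longlonglongrightarrow> \<langle>x, R x\<rangle> + 0 *\<^sub>R \<langle>x, x\<rangle>"
      by (intro tendsto_intros LIMSEQ_inverse_real_of_nat)
    hence "p \<longlonglongrightarrow> \<langle>x, R x\<rangle>" by (simp add: p_def[abs_def])
    moreover have "positive_within s (p n)" for n
    proof -
      define e where "e = inverse (real (Suc n))"
      have e: "e > 0" "e \<le> 1" by (simp_all add: e_def field_simps)
      obtain w where w: "selfadjoint w" "\<And>x. w (w x) = (t + e) *\<^sub>R x - (t *\<^sub>R x - R x)"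
        by (rule sqrt_shift[OF sa contr t(2), of "t + e"]) (use e in auto)
      have "\<langle>w x, w x\<rangle> = p n"
        unfolding p_def e_def[symmetric]
        by (simp add: selfadjointD[OF w(1)] w(2) ip_simps algebra_simps)
      moreover have "norm (p n) \<le> s"
      proof -
        have "norm (p n) \<le> norm \<langle>x, R x\<rangle> + norm (e *\<^sub>R \<langle>x, x\<rangle>)"
          unfolding p_def e_def by (rule norm_triangle_ineq)
        also have "norm (e *\<^sub>R \<langle>x, x\<rangle>) \<le> (norm x)\<^sup>2"
          using e by (simp add: norm_form mult_left_le_one_le)
        finally show ?thesis by (simp add: s_def)
      qed
      ultimately show ?thesis using positive_within_ip[of "w x" s] norm_form[of "w x"] by simp
    qed
    ultimately show "positive_within s \<langle>x, R x\<rangle>" by (rule positive_within_limit)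
  qed
  thus ?thesis using R by (simp add: form_positive_def)
qed

section \<open>Existence and uniqueness of positive square roots\<close>

text \<open>A root of \<open>A + e = 1 - ((1 - e) - A)\<close> comes from the contraction argument as \<open>S = 1 - Y\<close> with \<open>\<parallel>Y\<parallel> < 1\<close>,
  so it is itself a square \<open>K\<^sup>2\<close>. The inner root \<open>K\<close> witnesses that \<open>S\<close> is positive and that products of
  commuting operators \<open>S\<close> are.\<close>

lemma sqrt_shift_positive:
  assumes A: "form_positive A" and r: "\<And>x. norm (A x) \<le> r * norm x" "0 \<le> r" and e: "e > 0" "r + e < 1"
  obtains S K where "selfadjoint S" "\<And>x. S (S x) = A x + e *\<^sub>R x" "bicommutes S A"
    "\<And>x. norm (S x) \<le> 2 * norm x" "selfadjoint K" "\<And>x. K (K x) = S x" "bicommutes K A"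
proof -
  have sa: "selfadjoint A" using A by (rule form_positive_selfadjoint)
  define s where "s = 1 - e"
  have s: "0 \<le> s" "s < 1" "r < s" "s > 0" using e r by (auto simp: s_def)
  define X where "X x = s *\<^sub>R x - A x" for x
  have X: "selfadjoint X" using sa by (simp add: X_def selfadjoint_def ip_simps)
  have nX: "norm (X x) \<le> s * norm x" for x
  proof -
    have "norm (x - (1 / s) *\<^sub>R A x) \<le> norm x"
      by (rule norm_minus_form_positive_le[where r = "r / s"])
         (use form_positive_scaleR[OF A] r s in \<open>auto simp: field_simps\<close>)
    moreover have "X x = s *\<^sub>R (x - (1 / s) *\<^sub>R A x)" using s by (simp add: X_def algebra_simps)
    hence "norm (X x) = s * norm (x - (1 / s) *\<^sub>R A x)" using s by simp
    ultimately show ?thesis using s by (simp add: mult_left_mono)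
  qed
  obtain Y where Y: "selfadjoint Y" "\<And>x. norm (Y x) \<le> s * norm x"
    "\<And>x. 2 *\<^sub>R Y x - Y (Y x) = X x" "bicommutes Y X"
    using sqrt_one_minus[OF X nX s(1,2)] by blast
  interpret Y: bounded_linear Y by (rule selfadjoint_bounded_linear[OF Y(1)])
  define S where "S x = x - Y x" for x
  have S_sa: "selfadjoint S" using Y(1) by (simp add: S_def selfadjoint_def ip_simps)
  obtain K where K: "selfadjoint K" "\<And>x. K (K x) = 1 *\<^sub>R x - Y x" "bicommutes K Y"
    using sqrt_shift[OF Y(1,2) s(1,2)] by blast
  have "bicommutes X A"
    unfolding bicommutes_def by (simp add: X_def linear_diff linear_scale bounded_linear.linear)
  hence YA: "bicommutes Y A" by (rule bicommutes_trans[OF Y(4)])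
  show ?thesis
  proof
    show "selfadjoint S" by (rule S_sa)
    show "selfadjoint K" by (rule K(1))
    show "bicommutes K A" by (rule bicommutes_trans[OF K(3) YA])
    have "bicommutes S Y"
      unfolding bicommutes_def by (simp add: S_def linear_diff bounded_linear.linear)
    thus "bicommutes S A" using YA by (rule bicommutes_trans)
    fix x
    show "K (K x) = S x" by (simp add: K(2) S_def)
    have "S (S x) = x - (2 *\<^sub>R Y x - Y (Y x))" by (simp add: S_def Y.diff scaleR_2)
    also have "\<dots> = A x + e *\<^sub>R x" unfolding Y(3) X_def s_def by (simp add: algebra_simps)
    finally show "S (S x) = A x + e *\<^sub>R x" .
    have "norm (S x) \<le> norm x + norm (Y x)" unfolding S_def by (rule norm_triangle_ineq4)
    moreover have "s * norm x \<le> 1 * norm x" using s by (intro mult_right_mono) auto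
    ultimately show "norm (S x) \<le> 2 * norm x" using Y(2)[of x] by simp
  qed
qed

text \<open>The roots \<open>S\<^sub>n\<close> of \<open>A + e\<^sub>n\<close> converge as \<open>e\<^sub>n\<close> tends to \<open>0\<close>. For \<open>m \<le> n\<close> the difference \<open>D = S\<^sub>m - S\<^sub>n\<close>
  satisfies \<open>(S\<^sub>m + S\<^sub>n) D = e\<^sub>m - e\<^sub>n\<close>, and \<open>(S\<^sub>m + S\<^sub>n)\<^sup>2 \<ge> S\<^sub>m\<^sup>2 = A + e\<^sub>m \<ge> e\<^sub>m\<close> as the roots commute and are
  positive; hence \<open>\<parallel>D\<parallel> \<le> \<surd>e\<^sub>m\<close>.\<close>

lemma positive_sqrt_bounded:
  assumes A: "form_positive A" and le: "\<And>x. norm (A x) \<le> 1/3 * norm x"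
  obtains R where "form_positive R" "\<And>x. R (R x) = A x" "bicommutes R A"
proof -
  have sa: "selfadjoint A" using A by (rule form_positive_selfadjoint)
  note A_bl = selfadjoint_bounded_linear[OF sa]
  \<comment> \<open>Starting at \<open>1/2\<close> keeps \<open>1/3 + e n\<close> below \<open>1\<close>.\<close>
  define e where "e n = inverse (real (Suc (Suc n)))" for n
  have e: "e n > 0" "e n \<le> 1/2" for n by (simp_all add: e_def field_simps)
  have e_mono: "m \<le> n \<Longrightarrow> e n \<le> e m" for m n by (simp add: e_def field_simps)
  have e_lim: "e \<longlonglongrightarrow> 0"
    using LIMSEQ_Suc[OF LIMSEQ_inverse_real_of_nat] by (simp add: e_def[abs_def])
  have "\<exists>S K. selfadjoint S \<and> (\<forall>x. S (S x) = A x + e n *\<^sub>R x) \<and> bicommutes S A \<and>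
      (\<forall>x. norm (S x) \<le> 2 * norm x) \<and> selfadjoint K \<and> (\<forall>x. K (K x) = S x) \<and> bicommutes K A" for n
    by (rule sqrt_shift_positive[OF A le, of "e n"]) (use e[of n] in auto)
  then obtain S K where S_sa: "\<And>n. selfadjoint (S n)" and S: "\<And>n x. S n (S n x) = A x + e n *\<^sub>R x"
    "\<And>n. bicommutes (S n) A" "\<And>n x. norm (S n x) \<le> 2 * norm x"
    and K_sa: "\<And>n. selfadjoint (K n)" and K: "\<And>n x. K n (K n x) = S n x" "\<And>n. bicommutes (K n) A"
    by metis
  note S_bl = selfadjoint_bounded_linear[OF S_sa]
  have S_diff: "norm (S m x - S n x) \<le> sqrt (e m) * norm x" if mn: "m \<le> n" for m n x
  proof -
    interpret Sm: bounded_linear "S m" by (rule S_bl)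
    interpret Sn: bounded_linear "S n" by (rule S_bl)
    have comm: "S m (S n y) = S n (S m y)" for y
      by (rule bicommutes_commute[OF S(2) S(2) A_bl S_bl])
    have comm_K: "K m (K n y) = K n (K m y)" for y
      by (rule bicommutes_commute[OF K(2) K(2) A_bl selfadjoint_bounded_linear[OF K_sa]])
    have lower: "e m * (norm y)\<^sup>2 \<le> (norm (S m y + S n y))\<^sup>2" for y
    proof -
      define u where "u = K n (K m y)"
      have "\<langle>K m (K m y), K n (K n y)\<rangle> = \<langle>u, u\<rangle>"
        by (simp add: u_def selfadjointD[OF K_sa] comm_K)
      hence Smn: "\<langle>S m y, S n y\<rangle> = \<langle>u, u\<rangle>" by (simp add: K(1))
      have Snm: "\<langle>S n y, S m y\<rangle> = \<langle>u, u\<rangle>"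
        unfolding Smn[symmetric] by (simp add: selfadjointD[OF S_sa] comm)
      have "\<langle>S m y, S m y\<rangle> = \<langle>y, A y\<rangle> + e m *\<^sub>R \<langle>y, y\<rangle>"
        by (simp add: selfadjointD[OF S_sa] S(1) ip_simps)
      hence sum: "\<langle>S m y + S n y, S m y + S n y\<rangle>
          = (\<langle>y, A y\<rangle> + (\<langle>u, u\<rangle> + (\<langle>u, u\<rangle> + \<langle>S n y, S n y\<rangle>))) + e m *\<^sub>R \<langle>y, y\<rangle>"
        by (simp add: ip_simps Smn Snm)
      obtain t where t: "positive_within t \<langle>y, A y\<rangle>" using A by (rule form_positiveE)
      have "positive_within (e m * (norm y)\<^sup>2) (e m *\<^sub>R \<langle>y, y\<rangle>)"
        using e(1)[of m] by (intro positive_within_scaleR positive_within_ip) auto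
      moreover note positive_within_add[OF t positive_within_add[OF positive_within_ip[OF order_refl]
            positive_within_add[OF positive_within_ip[OF order_refl] positive_within_ip[OF order_refl]]]]
      ultimately have "norm (e m *\<^sub>R \<langle>y, y\<rangle>) \<le> norm \<langle>S m y + S n y, S m y + S n y\<rangle>"
        unfolding sum by (intro norm_le_add_positive)
      thus ?thesis using e(1)[of m] by (simp add: norm_form)
    qed
    define d where "d = S m x - S n x"
    have "S m d + S n d = (e m - e n) *\<^sub>R x"
      by (simp add: d_def Sm.diff Sn.diff S(1) comm algebra_simps)
    hence "norm (S m d + S n d) = (e m - e n) * norm x"
      using e_mono[OF mn] by simp
    also have "\<dots> \<le> e m * norm x" using e[of n] by (intro mult_right_mono) auto
    finally have "(norm (S m d + S n d))\<^sup>2 \<le> (e m * norm x)\<^sup>2" by (rule power_mono) simp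
    from order_trans[OF lower this] have "e m * (norm d)\<^sup>2 \<le> (e m * norm x)\<^sup>2" .
    also have "\<dots> = e m * (e m * (norm x)\<^sup>2)" by (simp add: power2_eq_square)
    finally have "(norm d)\<^sup>2 \<le> e m * (norm x)\<^sup>2" using e(1)[of m] by (simp only: mult_le_cancel_left_pos)
    also have "\<dots> = (sqrt (e m) * norm x)\<^sup>2" using e(1)[of m] by (simp add: power_mult_distrib)
    finally show ?thesis unfolding d_def[symmetric] by (rule power2_le_imp_le) (use e(1)[of m] in simp)
  qed
  have "convergent (\<lambda>n. S n x)" for x
  proof -
    have "(\<lambda>n. 2 * (sqrt (e n) * norm x)) \<longlonglongrightarrow> 2 * (sqrt 0 * norm x)"
      by (intro tendsto_intros e_lim)
    hence lim0: "(\<lambda>n. 2 * (sqrt (e n) * norm x)) \<longlonglongrightarrow> 0" unfolding real_sqrt_zero by simp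
    have "Cauchy (\<lambda>n. S n x)"
    proof (rule metric_CauchyI)
      fix \<epsilon> :: real assume "\<epsilon> > 0"
      then obtain M where M: "2 * (sqrt (e M) * norm x) < \<epsilon>"
        using eventually_happens[OF order_tendstoD(2)[OF lim0]] by auto
      have "dist (S m x) (S n x) < \<epsilon>" if "m \<ge> M" "n \<ge> M" for m n
      proof -
        have "dist (S m x) (S n x) \<le> dist (S M x) (S m x) + dist (S M x) (S n x)"
          by (metis dist_commute dist_triangle)
        also have "\<dots> \<le> sqrt (e M) * norm x + sqrt (e M) * norm x"
          unfolding dist_norm using that by (intro add_mono S_diff)
        finally show ?thesis using M by linarith
      qed
      thus "\<exists>M. \<forall>m\<ge>M. \<forall>n\<ge>M. dist (S m x) (S n x) < \<epsilon>" by blast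
    qed
    thus ?thesis by (rule Cauchy_convergent)
  qed
  then obtain R where R: "\<And>x. (\<lambda>n. S n x) \<longlonglongrightarrow> R x"
    unfolding convergent_def by metis
  have R_sa: "selfadjoint R"
    unfolding selfadjoint_def
  proof (intro allI)
    fix x y
    have "(\<lambda>n. \<langle>S n x, y\<rangle>) \<longlonglongrightarrow> \<langle>R x, y\<rangle>" "(\<lambda>n. \<langle>x, S n y\<rangle>) \<longlonglongrightarrow> \<langle>x, R y\<rangle>"
      by (intro tendsto_ip R tendsto_const)+
    thus "\<langle>R x, y\<rangle> = \<langle>x, R y\<rangle>" by (simp add: selfadjointD[OF S_sa] LIMSEQ_unique)
  qed
  show ?thesis
  proof
    have "positive_within (12 * norm x * norm x) \<langle>x, R x\<rangle>" for x
    proof (rule positive_within_limit)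
      show "(\<lambda>n. \<langle>x, S n x\<rangle>) \<longlonglongrightarrow> \<langle>x, R x\<rangle>" by (intro tendsto_ip R tendsto_const)
      fix n
      have eq: "\<langle>K n x, K n x\<rangle> = \<langle>x, S n x\<rangle>" by (simp add: selfadjointD[OF K_sa] K(1))
      have "norm \<langle>x, S n x\<rangle> \<le> 6 * norm x * norm (S n x)" by (rule norm_ip_le)
      also have "\<dots> \<le> 6 * norm x * (2 * norm x)" by (intro mult_left_mono S(3)) simp
      finally have "(norm (K n x))\<^sup>2 \<le> 12 * norm x * norm x"
        by (simp add: norm_form[symmetric] eq)
      thus "positive_within (12 * norm x * norm x) \<langle>x, S n x\<rangle>"
        unfolding eq[symmetric] by (rule positive_within_ip)
    qed
    thus "form_positive R" using R_sa by (auto simp: form_positive_def)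
    show "R (R x) = A x" for x
    proof (rule ip_eqI')
      fix z
      have "(\<lambda>n. \<langle>S n z, S n x\<rangle>) \<longlonglongrightarrow> \<langle>R z, R x\<rangle>" by (intro tendsto_ip R)
      moreover have "\<langle>S n z, S n x\<rangle> = \<langle>z, A x\<rangle> + e n *\<^sub>R \<langle>z, x\<rangle>" for n
        by (simp add: selfadjointD[OF S_sa] S(1) ip_simps)
      moreover have "(\<lambda>n. \<langle>z, A x\<rangle> + e n *\<^sub>R \<langle>z, x\<rangle>) \<longlonglongrightarrow> \<langle>z, A x\<rangle> + 0 *\<^sub>R \<langle>z, x\<rangle>"
        by (intro tendsto_intros e_lim)
      ultimately have "\<langle>R z, R x\<rangle> = \<langle>z, A x\<rangle>" by (simp add: LIMSEQ_unique)
      thus "\<langle>z, R (R x)\<rangle> = \<langle>z, A x\<rangle>" by (simp add: selfadjointD[OF R_sa])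
    qed
    show "bicommutes R A"
      unfolding bicommutes_def
    proof (intro allI impI)
      fix Z x assume Z: "bounded_linear Z" "\<forall>x. Z (A x) = A (Z x)"
      have "(\<lambda>n. Z (S n x)) \<longlonglongrightarrow> Z (R x)" by (rule bounded_linear.tendsto[OF Z(1) R])
      moreover have "Z (S n x) = S n (Z x)" for n by (rule bicommutesD[OF S(2) Z(1)]) (simp add: Z(2))
      ultimately show "Z (R x) = R (Z x)" using R[of "Z x"] by (simp add: LIMSEQ_unique)
    qed
  qed
qed

lemma positive_sqrt_exists:
  assumes A: "form_positive A"
  obtains R where "form_positive R" "\<And>x. R (R x) = A x" "bicommutes R A"
proof -
  have sa: "selfadjoint A" using A by (rule form_positive_selfadjoint)
  note A_bl = selfadjoint_bounded_linear[OF sa]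
  define N where "N = 3 * (onorm A + 1)"
  have N: "N > 0" using onorm_pos_le[OF A_bl] by (simp add: N_def)
  have fp: "form_positive (\<lambda>x. (1 / N) *\<^sub>R A x)" using A N by (simp add: form_positive_scaleR)
  have le: "norm ((1 / N) *\<^sub>R A x) \<le> 1/3 * norm x" for x
  proof -
    have "norm (A x) \<le> (onorm A + 1) * norm x"
      using onorm[OF A_bl, of x] norm_ge_zero[of x] unfolding distrib_right by linarith
    thus ?thesis using N by (simp add: N_def field_simps)
  qed
  obtain R where R: "form_positive R" "\<And>x. R (R x) = (1 / N) *\<^sub>R A x" "bicommutes R (\<lambda>x. (1 / N) *\<^sub>R A x)"
    using positive_sqrt_bounded[OF fp le] by blast
  interpret R: bounded_linear R
    by (rule selfadjoint_bounded_linear[OF form_positive_selfadjoint[OF R(1)]])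
  show ?thesis
  proof
    show "form_positive (\<lambda>x. sqrt N *\<^sub>R R x)" using R(1) N by (simp add: form_positive_scaleR)
    show "sqrt N *\<^sub>R R (sqrt N *\<^sub>R R x) = A x" for x using N by (simp add: R.scaleR R(2))
    show "bicommutes (\<lambda>x. sqrt N *\<^sub>R R x) A"
      unfolding bicommutes_def
    proof (intro allI impI)
      fix Z x assume Z: "bounded_linear Z" "\<forall>x. Z (A x) = A (Z x)"
      interpret Z: bounded_linear Z by fact
      have "Z (R x) = R (Z x)" by (rule bicommutesD[OF R(3) Z(1)]) (simp add: Z.scaleR Z(2))
      thus "Z (sqrt N *\<^sub>R R x) = sqrt N *\<^sub>R R (Z x)" by (simp add: Z.scaleR)
    qed
  qed
qed

lemma form_positive_eq_zero:
  assumes A: "form_positive A" and zero: "\<langle>x, A x\<rangle> = 0"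
  shows "A x = 0"
proof -
  obtain R where R: "form_positive R" "\<And>x. R (R x) = A x" using positive_sqrt_exists[OF A] by blast
  note R_sa = form_positive_selfadjoint[OF R(1)]
  have "\<langle>R x, R x\<rangle> = 0" using zero by (simp add: selfadjointD[OF R_sa] R(2))
  hence "R x = 0" by (rule ip_eq_zero)
  moreover have "R 0 = 0" using selfadjoint_bounded_linear[OF R_sa] by (simp add: linear_0 bounded_linear.linear)
  ultimately show ?thesis using R(2)[of x] by simp
qed

lemma positive_within_sum_zero:
  assumes "positive_within s p" "positive_within t q" "p + q = 0"
  shows "p = 0" "q = 0"
  using norm_le_add_positive[OF assms(1,2)] norm_le_add_positive[OF assms(2,1)] assms(3)
  by (simp_all add: add.commute)

text \<open>It suffices to compare with a root \<open>R\<close> in the bicommutant of \<open>A\<close>, which commutes with any other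
  root \<open>Q\<close> because \<open>Q\<close> commutes with \<open>A = Q\<^sup>2\<close>. Then \<open>(R + Q) (R - Q) = 0\<close>, so on the range of
  \<open>D = R - Q\<close> the positive forms of \<open>R\<close> and \<open>Q\<close> add up to zero. Hence both vanish there,
  \<open>R D = Q D = 0\<close>, and \<open>D\<^sup>2 = 0\<close>.\<close>

lemma positive_sqrt_unique:
  assumes R: "form_positive R" "\<And>x. R (R x) = A x" and Q: "form_positive Q" "\<And>x. Q (Q x) = A x"
  shows "R = Q"
proof -
  have eq: "R = Q" if R: "form_positive R" "\<And>x. R (R x) = A x" "bicommutes R A"
    and Q: "form_positive Q" "\<And>x. Q (Q x) = A x" for R Q
  proof
    fix x
    note R_sa = form_positive_selfadjoint[OF R(1)] and Q_sa = form_positive_selfadjoint[OF Q(1)]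
    interpret R: bounded_linear R by (rule selfadjoint_bounded_linear[OF R_sa])
    interpret Q: bounded_linear Q by (rule selfadjoint_bounded_linear[OF Q_sa])
    have comm: "Q (R y) = R (Q y)" for y
      by (rule bicommutesD[OF R(3) Q.bounded_linear_axioms]) (simp flip: Q(2))
    define D where "D y = R y - Q y" for y
    have D_sa: "selfadjoint D" using R_sa Q_sa by (simp add: D_def selfadjoint_def ip_simps)
    have sum0: "\<langle>D y, R (D y)\<rangle> + \<langle>D y, Q (D y)\<rangle> = 0" for y
    proof -
      have "R (D y) + Q (D y) = 0" by (simp add: D_def R.diff Q.diff R(2) Q(2) comm)
      thus ?thesis by (simp flip: ip_add)
    qed
    have "\<langle>D y, R (D y)\<rangle> = 0 \<and> \<langle>D y, Q (D y)\<rangle> = 0" for y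
    proof -
      obtain s where "positive_within s \<langle>D y, R (D y)\<rangle>" using R(1) by (rule form_positiveE)
      moreover obtain t where "positive_within t \<langle>D y, Q (D y)\<rangle>" using Q(1) by (rule form_positiveE)
      ultimately show ?thesis using positive_within_sum_zero sum0 by blast
    qed
    hence "R (D y) = 0" "Q (D y) = 0" for y using form_positive_eq_zero R(1) Q(1) by blast+
    hence "D (D x) = 0" by (simp add: D_def[of "D x"])
    hence "\<langle>D x, D x\<rangle> = 0" by (simp add: selfadjointD[OF D_sa])
    hence "D x = 0" by (rule ip_eq_zero)
    thus "R x = Q x" by (simp add: D_def)
  qed
  have "form_positive A"
    using form_positive_selfadjoint[OF R(1)] R(2)
    by (intro form_positiveI_square[of A R]) (simp_all add: selfadjoint_def flip: R(2))
  then obtain P where P: "form_positive P" "\<And>x. P (P x) = A x" "bicommutes P A"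
    using positive_sqrt_exists by blast
  show ?thesis using eq[OF P R] eq[OF P Q] by simp
qed

section \<open>The modulus of an adjointable operator\<close>

lemma adj_adjointable: "T \<in> \<L> \<Longrightarrow> T\<^sup>\<dagger> \<in> \<L>"
  using is_adjoint_adj is_adjoint_sym adjointableI by blast

lemma adj_adj: "T \<in> \<L> \<Longrightarrow> T\<^sup>\<dagger>\<^sup>\<dagger> = T"
  using is_adjoint_adj is_adjoint_sym adj_eqI by blast

lemma ip_adj: "T \<in> \<L> \<Longrightarrow> \<langle>T x, y\<rangle> = \<langle>x, T\<^sup>\<dagger> y\<rangle>"
  using is_adjoint_adj is_adjointD by blast

lemma ip_adj': "T \<in> \<L> \<Longrightarrow> \<langle>T\<^sup>\<dagger> x, y\<rangle> = \<langle>x, T y\<rangle>"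
  using ip_adj[OF adj_adjointable] adj_adj by metis

lemma is_adjoint_comp: "is_adjoint S S' \<Longrightarrow> is_adjoint T T' \<Longrightarrow> is_adjoint (S \<circ> T) (T' \<circ> S')"
  by (simp add: is_adjoint_def)

lemma comp_adjointable: "S \<in> \<L> \<Longrightarrow> T \<in> \<L> \<Longrightarrow> S \<circ> T \<in> \<L>"
  using is_adjoint_comp is_adjoint_adj adjointableI by blast

lemma adj_comp: "S \<in> \<L> \<Longrightarrow> T \<in> \<L> \<Longrightarrow> (S \<circ> T)\<^sup>\<dagger> = T\<^sup>\<dagger> \<circ> S\<^sup>\<dagger>"
  using is_adjoint_comp is_adjoint_adj adj_eqI by blast

lemma adjointable_bounded_linear: "T \<in> \<L> \<Longrightarrow> bounded_linear T"
  using bounded_linear_if_adjoint ip_adj by blast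

lemma adjointable_act:
  assumes "T \<in> \<L>"
  shows "T (x \<cdot> a) = T x \<cdot> a"
  by (rule ip_eqI') (simp add: ip_act_right flip: ip_adj'[OF assms])

lemma adjointable_scaleC:
  assumes "T \<in> \<L>"
  shows "T (c *\<^sub>C x) = c *\<^sub>C T x"
  by (rule ip_eqI') (simp add: ip_scaleC flip: ip_adj'[OF assms])

lemma op_sqrt_eqI:
  assumes R: "form_positive R" "\<And>x. R (R x) = A x"
  shows "op_sqrt A = R"
  unfolding op_sqrt_def
proof (rule the_equality)
  show "positive_op R \<and> R \<circ> R = A"
    using R form_positive_imp_positive_op by (simp add: fun_eq_iff)
  fix Q assume "positive_op Q \<and> Q \<circ> Q = A"
  thus "Q = R"
    using positive_sqrt_unique[OF _ _ R] positive_op_imp_form_positive by (auto simp: fun_eq_iff)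
qed

lemma op_abs_eqI:
  "form_positive R \<Longrightarrow> (\<And>x. R (R x) = T\<^sup>\<dagger> (T x)) \<Longrightarrow> op_abs T = R"
  unfolding op_abs_def by (rule op_sqrt_eqI) simp_all

lemma op_abs:
  assumes T: "T \<in> \<L>"
  shows "form_positive (op_abs T)" "op_abs T (op_abs T x) = T\<^sup>\<dagger> (T x)"
proof -
  have "form_positive (\<lambda>x. T\<^sup>\<dagger> (T x))"
    by (rule form_positiveI_square[of _ T]) (simp_all add: selfadjoint_def ip_adj[OF T] ip_adj'[OF T])
  then obtain R where R: "form_positive R" "\<And>x. R (R x) = T\<^sup>\<dagger> (T x)"
    using positive_sqrt_exists by blast
  hence "op_abs T = R" by (rule op_abs_eqI)
  thus "form_positive (op_abs T)" "op_abs T (op_abs T x) = T\<^sup>\<dagger> (T x)" using R by simp_all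
qed

lemma op_abs_selfadjoint: "T \<in> \<L> \<Longrightarrow> selfadjoint (op_abs T)"
  using op_abs(1) form_positive_selfadjoint by blast

lemma op_abs_adjointable: "T \<in> \<L> \<Longrightarrow> op_abs T \<in> \<L>"
  using op_abs_selfadjoint selfadjoint_iff by blast

text \<open>\<open>\<parallel>|T| z\<parallel> = \<parallel>T z\<parallel>\<close>, so \<open>T\<close> and \<open>|T|\<close> have the same kernel.\<close>

lemma op_abs_cong:
  assumes T: "T \<in> \<L>" and eq: "T x = T y"
  shows "op_abs T x = op_abs T y"
proof -
  interpret T: bounded_linear T by (rule adjointable_bounded_linear[OF T])
  interpret M: bounded_linear "op_abs T" by (rule adjointable_bounded_linear[OF op_abs_adjointable[OF T]])
  have "\<langle>op_abs T (x - y), op_abs T (x - y)\<rangle> = \<langle>T (x - y), T (x - y)\<rangle>"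
    by (simp add: selfadjointD[OF op_abs_selfadjoint[OF T]] op_abs(2)[OF T] ip_adj[OF T])
  also have "\<dots> = 0" by (simp add: T.diff eq)
  finally have "op_abs T (x - y) = 0" by (rule ip_eq_zero)
  thus ?thesis by (simp add: M.diff)
qed

section \<open>Projections and polar decompositions\<close>

lemma proj_onto_eqI:
  assumes M: "orthogonally_complemented M" and m: "m \<in> M" "x - m \<in> orth_compl M"
  shows "proj_onto M x = m"
  unfolding proj_onto_def
proof (rule the_equality)
  fix n assume n: "n \<in> M \<and> x - n \<in> orth_compl M"
  have sub: "submodule M" and int: "M \<inter> orth_compl M = {0}" using M by (simp_all add: orthogonally_complemented_def)
  have "(- 1) *\<^sub>C m = - m" by (simp add: scaleC_minus_left scaleC_one)
  hence "n + - m \<in> M" using sub n m unfolding submodule_def by metis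
  moreover have "n - m = (x - m) - (x - n)" by simp
  hence "n - m \<in> orth_compl M" using n m by (simp only: orth_compl_def mem_Collect_eq ip_diff') simp
  ultimately have "n - m \<in> M \<inter> orth_compl M" by simp
  thus "n = m" unfolding int by simp
qed (use m in simp)

lemma proj_onto:
  assumes M: "orthogonally_complemented M"
  shows "proj_onto M x \<in> M" "x \<in> M \<Longrightarrow> proj_onto M x = x"
proof -
  have "x \<in> {m + n | m n. m \<in> M \<and> n \<in> orth_compl M}" using M by (simp add: orthogonally_complemented_def)
  then obtain m n where "x = m + n" "m \<in> M" "n \<in> orth_compl M" by blast
  thus "proj_onto M x \<in> M" using proj_onto_eqI[OF M, of m x] by simp
  have "0 \<in> orth_compl M" by (simp add: orth_compl_def)
  thus "x \<in> M \<Longrightarrow> proj_onto M x = x" using proj_onto_eqI[OF M, of x x] by simp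
qed

lemma range_selfadjoint_idempotent:
  assumes Q: "selfadjoint Q" "\<And>x. Q (Q x) = Q x"
  shows "orthogonally_complemented (range Q)" "proj_onto (range Q) = Q"
proof -
  have QL: "Q \<in> \<L>" using Q(1) selfadjoint_iff by blast
  interpret Q: bounded_linear Q by (rule selfadjoint_bounded_linear[OF Q(1)])
  have fixed: "range Q = {x. Q x = x}" using Q(2) by (auto intro: rangeI[of Q] simp: image_iff) metis
  have perp: "x - Q x \<in> orth_compl (range Q)" for x
    by (auto simp: orth_compl_def selfadjointD[OF Q(1), symmetric] Q.diff Q(2))
  show compl: "orthogonally_complemented (range Q)"
    unfolding orthogonally_complemented_def
  proof (intro conjI)
    show "closed (range Q)"
      unfolding fixed by (intro closed_Collect_eq continuous_intros Q.continuous_on)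
    show "submodule (range Q)"
      unfolding submodule_def fixed
      by (simp add: Q.add Q.zero adjointable_scaleC[OF QL] adjointable_act[OF QL])
    have "x \<in> {m + n | m n. m \<in> range Q \<and> n \<in> orth_compl (range Q)}" for x
    proof -
      have "x = Q x + (x - Q x)" by simp
      thus ?thesis using perp[of x] by blast
    qed
    thus "{m + n | m n. m \<in> range Q \<and> n \<in> orth_compl (range Q)} = UNIV" by blast
    have "x = 0" if "x \<in> range Q" "x \<in> orth_compl (range Q)" for x
      using that ip_eq_zero by (auto simp: orth_compl_def)
    moreover have "0 \<in> range Q" "0 \<in> orth_compl (range Q)"
      by (simp_all add: fixed Q.zero orth_compl_def)
    ultimately show "range Q \<inter> orth_compl (range Q) = {0}" by blast
  qed
  show "proj_onto (range Q) = Q"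
    by (rule ext, rule proj_onto_eqI[OF compl]) (simp_all add: perp)
qed

text \<open>The identities follow from two facts: \<open>P = U\<^sup>\<dagger> U\<close> fixes the range of \<open>T\<^sup>\<dagger>\<close>, so that \<open>T P = T\<close> and with it
  \<open>|T| P = |T|\<close>; and \<open>U\<close> vanishes on the kernel of \<open>P\<close>.\<close>

lemma polar_decompositionD:
  assumes T: "T \<in> \<L>" and pd: "polar_decomposition T U"
  shows "U \<in> \<L>" "T x = U (op_abs T x)"
    "selfadjoint (\<lambda>x. U\<^sup>\<dagger> (U x))"
    "U\<^sup>\<dagger> (U x) \<in> closure (range (T\<^sup>\<dagger>))"
    "U\<^sup>\<dagger> (U (T\<^sup>\<dagger> x)) = T\<^sup>\<dagger> x"
    "U (U\<^sup>\<dagger> (U x)) = U x"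
    "U\<^sup>\<dagger> (U (op_abs T x)) = op_abs T x"
    "op_abs T (U\<^sup>\<dagger> x) = T\<^sup>\<dagger> x"
    "U (U\<^sup>\<dagger> (T x)) = T x"
proof -
  let ?P = "\<lambda>x. U\<^sup>\<dagger> (U x)" and ?M = "closure (range (T\<^sup>\<dagger>))"
  show U: "U \<in> \<L>" using pd by (simp add: polar_decomposition_def partial_isometry_def)
  have "T = U \<circ> op_abs T" using pd by (simp add: polar_decomposition_def)
  thus T_eq: "T x = U (op_abs T x)" for x by (metis comp_apply)
  have "(U\<^sup>\<dagger> \<circ> U) \<circ> (U\<^sup>\<dagger> \<circ> U) = U\<^sup>\<dagger> \<circ> U"
    using pd unfolding polar_decomposition_def partial_isometry_def projection_def by blast
  hence idem: "?P (?P x) = ?P x" for x by (metis comp_apply)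
  show P_sa: "selfadjoint ?P" by (simp add: selfadjoint_def ip_adj[OF U] ip_adj'[OF U])
  have compl: "orthogonally_complemented ?M" and "U\<^sup>\<dagger> \<circ> U = proj_onto ?M"
    using pd by (simp_all add: polar_decomposition_def)
  hence P_eq: "?P x = proj_onto ?M x" for x by (metis comp_apply)
  show "?P x \<in> ?M" unfolding P_eq by (rule proj_onto(1)[OF compl])
  have PT: "?P (T\<^sup>\<dagger> y) = T\<^sup>\<dagger> y" for y
    unfolding P_eq by (rule proj_onto(2)[OF compl subsetD[OF closure_subset rangeI]])
  thus "?P (T\<^sup>\<dagger> x) = T\<^sup>\<dagger> x" .
  interpret U: bounded_linear U by (rule adjointable_bounded_linear[OF U])
  interpret U': bounded_linear "U\<^sup>\<dagger>" by (rule adjointable_bounded_linear[OF adj_adjointable[OF U]])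
  show UP: "U (?P y) = U y" for y
  proof -
    have "\<langle>U (y - ?P y), U (y - ?P y)\<rangle> = \<langle>y - ?P y, ?P (y - ?P y)\<rangle>" by (simp add: ip_adj[OF U])
    also have "\<dots> = 0" by (simp add: U.diff U'.diff idem)
    finally have "U (y - ?P y) = 0" by (rule ip_eq_zero)
    thus ?thesis by (simp add: U.diff)
  qed
  note M_sa = op_abs_selfadjoint[OF T]
  have TP: "T (?P y) = T y" for y
    by (rule ip_eqI) (simp add: ip_adj[OF T] selfadjointD[OF P_sa] PT)
  have "op_abs T (?P y) = op_abs T y" for y by (rule op_abs_cong[OF T]) (rule TP)
  hence MP: "op_abs T (?P y) = op_abs T y" for y .
  show PM: "?P (op_abs T y) = op_abs T y" for y
    by (rule ip_eqI) (simp add: selfadjointD[OF P_sa] selfadjointD[OF M_sa] MP)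
  show "op_abs T (U\<^sup>\<dagger> x) = T\<^sup>\<dagger> x"
    by (rule ip_eqI) (simp add: selfadjointD[OF M_sa] ip_adj'[OF U] ip_adj'[OF T] T_eq)
  show "U (U\<^sup>\<dagger> (T x)) = T x" by (simp add: T_eq PM)
qed

text \<open>The modulus of \<open>U A V\<close> is \<open>V\<^sup>\<dagger> |A| V\<close>: the square of this form positive operator is
  \<open>V\<^sup>\<dagger> |A| V V\<^sup>\<dagger> |A| V = V\<^sup>\<dagger> |A|\<^sup>2 V = (U A V)\<^sup>\<dagger> (U A V)\<close>, as \<open>V V\<^sup>\<dagger>\<close> and \<open>U\<^sup>\<dagger> U\<close> act as identities next to \<open>A\<close>.
  The initial projection of \<open>U W V\<close> is \<open>Q = V\<^sup>\<dagger> W\<^sup>\<dagger> W V\<close>, whose range is the image under \<open>V\<^sup>\<dagger>\<close> of the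
  closure of the range of \<open>A\<^sup>\<dagger>\<close>, and this is the closure of the range of \<open>(U A V)\<^sup>\<dagger>\<close>.\<close>

lemma polar_decomposition_sandwich:
  assumes A: "A \<in> \<L>" and U: "U \<in> \<L>" and V: "V \<in> \<L>" and pd: "polar_decomposition A W"
    and UUA: "U\<^sup>\<dagger> \<circ> U \<circ> A = A" and AVV: "A \<circ> V \<circ> V\<^sup>\<dagger> = A"
  shows "polar_decomposition (U \<circ> A \<circ> V) (U \<circ> W \<circ> V)"
proof -
  have UA: "U\<^sup>\<dagger> (U (A x)) = A x" and AV: "A (V (V\<^sup>\<dagger> x)) = A x" for x
    using UUA AVV by (metis comp_apply)+
  note pdD = polar_decompositionD[OF A pd]
  note W = pdD(1)
  let ?P = "\<lambda>x. W\<^sup>\<dagger> (W x)" and ?M = "closure (range (A\<^sup>\<dagger>))"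
  define B where "B = U \<circ> A \<circ> V"
  define Q where "Q x = V\<^sup>\<dagger> (?P (V x))" for x
  have B: "B \<in> \<L>" unfolding B_def by (intro comp_adjointable A U V)
  have B_adj: "B\<^sup>\<dagger> = (\<lambda>x. V\<^sup>\<dagger> (A\<^sup>\<dagger> (U\<^sup>\<dagger> x)))"
    unfolding B_def by (simp add: adj_comp comp_adjointable A U V fun_eq_iff)
  have X_adj: "(U \<circ> W \<circ> V)\<^sup>\<dagger> = (\<lambda>x. V\<^sup>\<dagger> (W\<^sup>\<dagger> (U\<^sup>\<dagger> x)))"
    by (simp add: adj_comp comp_adjointable W U V fun_eq_iff)
  have AU: "A\<^sup>\<dagger> (U\<^sup>\<dagger> (U x)) = A\<^sup>\<dagger> x" for x
    by (rule ip_eqI') (simp add: UA flip: ip_adj[OF A] ip_adj[OF U] ip_adj'[OF U])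
  have VA: "V (V\<^sup>\<dagger> (A\<^sup>\<dagger> x)) = A\<^sup>\<dagger> x" for x
    by (rule ip_eqI') (simp add: AV flip: ip_adj[OF A] ip_adj[OF V] ip_adj'[OF V])
  note cont = linear_continuous_on[OF adjointable_bounded_linear]
  have closed_eq: "closed {x. f (g x) = h x}" if "f \<in> \<L>" "g \<in> \<L>" "h \<in> \<L>" for f g h
    by (intro closed_Collect_eq cont that continuous_on_compose2[OF cont[OF that(1)] cont[OF that(2)]]) auto
  have id: "id \<in> \<L>" by (rule adjointableI[of _ id]) (simp add: is_adjoint_def)
  have "?M \<subseteq> {x. V (V\<^sup>\<dagger> x) = id x}"
    by (rule closure_minimal[OF _ closed_eq[OF V adj_adjointable[OF V] id]]) (auto simp: VA)
  hence VP: "V (V\<^sup>\<dagger> (?P x)) = ?P x" for x using pdD(4) by auto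
  have WA: "U\<^sup>\<dagger> (U (W (A\<^sup>\<dagger> x))) = W (A\<^sup>\<dagger> x)" for x
    by (simp add: UA flip: pdD(8) pdD(2))
  have "?M \<subseteq> {x. (U\<^sup>\<dagger> \<circ> U) (W x) = W x}"
    by (rule closure_minimal[OF _ closed_eq[OF comp_adjointable[OF adj_adjointable[OF U] U] W W]]) (auto simp: WA)
  hence UW: "U\<^sup>\<dagger> (U (W x)) = W x" for x
    using pdD(4)[of x] pdD(6)[of x] by (metis (mono_tags, lifting) comp_apply mem_Collect_eq subsetD)
  note M_sa = op_abs_selfadjoint[OF A]
  have MV: "op_abs A (V (V\<^sup>\<dagger> x)) = op_abs A x" for x by (rule op_abs_cong[OF A]) (rule AV)
  have B_abs: "op_abs B = (\<lambda>x. V\<^sup>\<dagger> (op_abs A (V x)))"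
  proof (rule op_abs_eqI)
    show "form_positive (\<lambda>x. V\<^sup>\<dagger> (op_abs A (V x)))"
      unfolding form_positive_def
    proof (intro conjI allI)
      show "selfadjoint (\<lambda>x. V\<^sup>\<dagger> (op_abs A (V x)))"
        by (simp add: selfadjoint_def ip_adj'[OF V] selfadjointD[OF M_sa] ip_adj[OF V])
      show "\<exists>t. positive_within t \<langle>x, V\<^sup>\<dagger> (op_abs A (V x))\<rangle>" for x
        using op_abs(1)[OF A] by (simp add: form_positive_def flip: ip_adj[OF V])
    qed
    show "V\<^sup>\<dagger> (op_abs A (V (V\<^sup>\<dagger> (op_abs A (V x))))) = B\<^sup>\<dagger> (B x)" for x
      by (simp add: MV op_abs(2)[OF A] B_adj UA) (simp add: B_def UA)
  qed
  have Q_sa: "selfadjoint Q"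
    by (simp add: selfadjoint_def Q_def ip_adj[OF V] ip_adj'[OF V] ip_adj[OF W] ip_adj'[OF W])
  have Q_idem: "Q (Q x) = Q x" for x
    by (simp add: Q_def VP pdD(6))
  have XX: "(U \<circ> W \<circ> V)\<^sup>\<dagger> \<circ> (U \<circ> W \<circ> V) = Q"
    unfolding X_adj by (simp add: fun_eq_iff Q_def UW)
  have range_B: "range (B\<^sup>\<dagger>) = V\<^sup>\<dagger> ` range (A\<^sup>\<dagger>)"
    unfolding B_adj using AU by (auto simp: image_iff) metis+
  note Qr = range_selfadjoint_idempotent[OF Q_sa Q_idem]
  have closure_B: "closure (range (B\<^sup>\<dagger>)) = range Q"
  proof
    have "V\<^sup>\<dagger> (A\<^sup>\<dagger> x) = Q (V\<^sup>\<dagger> (A\<^sup>\<dagger> x))" for x by (simp add: Q_def VA pdD(5))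
    hence "range (B\<^sup>\<dagger>) \<subseteq> range Q" unfolding range_B by blast
    moreover have "closed (range Q)" using Qr(1) by (simp add: orthogonally_complemented_def)
    ultimately show "closure (range (B\<^sup>\<dagger>)) \<subseteq> range Q" by (rule closure_minimal)
    have "V\<^sup>\<dagger> ` ?M \<subseteq> closure (V\<^sup>\<dagger> ` range (A\<^sup>\<dagger>))"
      by (intro image_closure_subset[OF cont[OF adj_adjointable[OF V]] closed_closure closure_subset])
    thus "range Q \<subseteq> closure (range (B\<^sup>\<dagger>))"
      unfolding range_B Q_def using pdD(4) by blast
  qed
  show ?thesis
    unfolding polar_decomposition_def B_def[symmetric] closure_B XX
  proof (intro conjI)
    show "partial_isometry (U \<circ> W \<circ> V)"
      unfolding partial_isometry_def XX projection_def
      using Q_sa Q_idem comp_adjointable W U V by (auto simp: selfadjoint_iff fun_eq_iff)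
    have VM: "V (V\<^sup>\<dagger> (op_abs A z)) = op_abs A z" for z
      by (rule ip_eqI') (simp add: MV flip: selfadjointD[OF M_sa] ip_adj[OF V] ip_adj'[OF V])
    have "U (W (V (op_abs B x))) = U (A (V x))" for x
      by (simp only: B_abs VM pdD(2))
    thus "B = U \<circ> W \<circ> V \<circ> op_abs B" by (simp add: fun_eq_iff B_def)
    show "orthogonally_complemented (range Q)" by (rule Qr(1))
    show "Q = proj_onto (range Q)" by (simp add: Qr(2))
  qed
qed

text \<open>Since \<open>S = V |S|\<close>, the modulus of \<open>S\<^sup>\<dagger>\<close> is \<open>V |S| V\<^sup>\<dagger>\<close>, which gives \<open>S = |S\<^sup>\<dagger>| V\<close>.\<close>

theorem has_polar_decomposition_comp_iff:
  assumes T: "T \<in> \<L>" and S: "S \<in> \<L>"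
    and TU: "polar_decomposition T U" and SV: "polar_decomposition S V"
  shows "has_polar_decomposition (T \<circ> S) \<longleftrightarrow> has_polar_decomposition (op_abs T \<circ> op_abs (S\<^sup>\<dagger>))"
proof -
  note U = polar_decompositionD[OF T TU]
  note V = polar_decompositionD[OF S SV]
  note S' = adj_adjointable[OF S]
  note M_sa = op_abs_selfadjoint[OF S]
  have abs_adj: "op_abs (S\<^sup>\<dagger>) = (\<lambda>x. V (op_abs S (V\<^sup>\<dagger> x)))"
  proof (rule op_abs_eqI)
    show "form_positive (\<lambda>x. V (op_abs S (V\<^sup>\<dagger> x)))"
      unfolding form_positive_def
    proof (intro conjI allI)
      show "selfadjoint (\<lambda>x. V (op_abs S (V\<^sup>\<dagger> x)))"
        by (simp add: selfadjoint_def ip_adj[OF V(1)] selfadjointD[OF M_sa] ip_adj'[OF V(1)])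
      show "\<exists>t. positive_within t \<langle>x, V (op_abs S (V\<^sup>\<dagger> x))\<rangle>" for x
        using op_abs(1)[OF S] by (simp add: form_positive_def flip: ip_adj'[OF V(1)])
    qed
    show "V (op_abs S (V\<^sup>\<dagger> (V (op_abs S (V\<^sup>\<dagger> x))))) = S\<^sup>\<dagger>\<^sup>\<dagger> (S\<^sup>\<dagger> x)" for x
      by (simp add: V(7) adj_adj[OF S]) (simp add: V(2) flip: V(8))
  qed
  define A where "A = op_abs T \<circ> op_abs (S\<^sup>\<dagger>)"
  have A: "A \<in> \<L>" unfolding A_def by (intro comp_adjointable op_abs_adjointable T S')
  have TS: "T \<circ> S \<in> \<L>" by (intro comp_adjointable T S)
  have UA: "U\<^sup>\<dagger> \<circ> U \<circ> A = A" by (simp add: fun_eq_iff A_def U(7))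
  have AV: "A \<circ> V \<circ> V\<^sup>\<dagger> = A"
  proof -
    have "V\<^sup>\<dagger> (V (V\<^sup>\<dagger> x)) = V\<^sup>\<dagger> x" for x
      by (rule ip_eqI') (simp add: V(6) flip: ip_adj[OF V(1)] ip_adj'[OF V(1)])
    thus ?thesis by (simp add: fun_eq_iff A_def abs_adj)
  qed
  have absV: "op_abs (S\<^sup>\<dagger>) (V x) = S x" for x
  proof -
    have "op_abs S (V\<^sup>\<dagger> (V x)) = op_abs S x"
      by (rule ip_eqI') (simp add: V(7) flip: selfadjointD[OF M_sa] ip_adj[OF V(1)] ip_adj'[OF V(1)])
    thus ?thesis by (simp add: abs_adj V(2))
  qed
  have TS_eq: "T \<circ> S = U \<circ> A \<circ> V" by (simp add: fun_eq_iff A_def absV U(2))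
  have "U\<^sup>\<dagger> \<circ> (T \<circ> S) \<circ> V\<^sup>\<dagger> = (U\<^sup>\<dagger> \<circ> U \<circ> A) \<circ> V \<circ> V\<^sup>\<dagger>" unfolding TS_eq by (simp only: o_assoc)
  hence A_eq: "U\<^sup>\<dagger> \<circ> (T \<circ> S) \<circ> V\<^sup>\<dagger> = A" by (simp only: UA AV)
  show ?thesis
    unfolding A_def[symmetric] has_polar_decomposition_def
  proof
    assume "\<exists>W. polar_decomposition A W"
    then obtain W where "polar_decomposition A W" ..
    from polar_decomposition_sandwich[OF A U(1) V(1) this UA AV]
    show "\<exists>W. polar_decomposition (T \<circ> S) W" unfolding TS_eq by blast
  next
    assume "\<exists>W. polar_decomposition (T \<circ> S) W"
    then obtain W where W: "polar_decomposition (T \<circ> S) W" ..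
    have "polar_decomposition (U\<^sup>\<dagger> \<circ> (T \<circ> S) \<circ> V\<^sup>\<dagger>) (U\<^sup>\<dagger> \<circ> W \<circ> V\<^sup>\<dagger>)"
    proof (rule polar_decomposition_sandwich[OF TS adj_adjointable[OF U(1)] adj_adjointable[OF V(1)] W])
      show "U\<^sup>\<dagger>\<^sup>\<dagger> \<circ> U\<^sup>\<dagger> \<circ> (T \<circ> S) = T \<circ> S"
        by (simp add: fun_eq_iff adj_adj[OF U(1)] U(9))
      show "T \<circ> S \<circ> V\<^sup>\<dagger> \<circ> V\<^sup>\<dagger>\<^sup>\<dagger> = T \<circ> S"
        unfolding adj_adj[OF V(1)] by (simp add: fun_eq_iff V(6) flip: absV)
    qed
    thus "\<exists>W. polar_decomposition A W" unfolding A_eq by blast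
  qed
qed

end

theorem lemma3p1:
  fixes ip :: "'h::complex_banach \<Rightarrow> 'h \<Rightarrow> 'a::cstar_algebra"
    and act :: "'h \<Rightarrow> 'a \<Rightarrow> 'h"
    and T S U V :: "'h \<Rightarrow> 'h"
  assumes "hilbert_module ip act"
    and "T \<in> hilbert_module.adjointable ip"
    and "S \<in> hilbert_module.adjointable ip"
    and "hilbert_module.polar_decomposition ip act T U"
    and "hilbert_module.polar_decomposition ip act S V"
  shows "hilbert_module.has_polar_decomposition ip act (T \<circ> S) \<longleftrightarrow>
    hilbert_module.has_polar_decomposition ip act
      (hilbert_module.op_abs ip T \<circ> hilbert_module.op_abs ip (hilbert_module.adj ip S))"
  using hilbert_module.has_polar_decomposition_comp_iff[OF assms] .

end
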